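(* Let $G$ be a connected graph with $N_0$ vertices and $E_0$ edges, let $n\ge 2$ be even, and let $\tau_n(G)$ be the $n$-polygon graph of $G$. The eigenvalues of the normalized Laplacian $\mathcal{L}_{\tau_n(G)}$ can be obtained in the following way. (i) $0$ is an eigenvalue of $\mathcal{L}_{\tau_n(G)}$ with multiplicity $1$. (ii) If $\mu$ is any root of $a_{\frac{n}{2}}(\mu)+a_{\frac{n}{2}-1}(\mu)=0$, then $\mu$ is an eigenvalue of $\mathcal{L}_{\tau_n(G)}$ with multiplicity $N_0$. (iii) If $\mu$ is any root of $a_{\frac{n}{2}-1}(\mu)=0$, then $\mu$ is an eigenvalue of $\mathcal{L}_{\tau_n(G)}$ with multiplicity $E_0-N_0+1$. (iv) If $G$ is non-bipartite and $\mu$ is any root of $a_{\frac{n}{2}}(\mu)-a_{\frac{n}{2}-2}(\mu)=0$, then $\mu$ is an eigenvalue of $\mathcal{L}_{\tau_n(G)}$ with multiplicity $E_0-N_0$. (v) If $G$ is bipartite and $\mu$ is any root of $a_{\frac{n}{2}}(\mu)-a_{\frac{n}{2}-2}(\mu)=0$, then $\mu$ is an eigenvalue of $\mathcal{L}_{\tau_n(G)}$ with multiplicity $E_0-N_0+1$. (vi) Let $\lambda$ be any eigenvalue of $\mathcal{L}_G$ with $\lambda\ne 0$ and $\lambda\neq 2$, and let $\mu_i(\lambda)$, $i=1,2,\dots,\frac{n}{2}$, be the roots of the equation (in $x$) $$1-\frac{a_{\frac{n}{2}}(x)-a_{\frac{n}{2}-1}(x)}{a_{\frac{n}{2}-1}(x)-a_{\frac{n}{2}-2}(x)}=\lambda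 .$$ Then each $\mu_i(\lambda)$, $i=1,\dots,\frac{n}{2}$, is an eigenvalue of $\mathcal{L}_{\tau_n(G)}$, and $m_{\mathcal{L}_G}(\lambda)=m_{\mathcal{L}_{\tau_n(G)}}(\mu_i(\lambda))$ for $i=1,\dots,\frac{n}{2}$.
   Context: Graphs are finite, simple and undirected; $G$ has at least one edge, so all degrees are positive. For a graph $H$ with adjacency matrix $A(H)$ and diagonal degree matrix $D(H)$, the normalized Laplacian is $\mathcal{L}_H=I-D(H)^{-1/2}A(H)D(H)^{-1/2}$, and $m_{\mathcal{L}_H}(\lambda)$ denotes the multiplicity of $\lambda$ as an eigenvalue of $\mathcal{L}_H$. "Eigenvalue with multiplicity $0$" means not an eigenvalue. For $n\ge 2$, the $n$-polygon graph $\tau_n(G)$ is obtained from $G$ by adding, for each edge $ij$ of $G$, a new path of length $n$ (with $n-1$ new internal vertices) joining $i$ and $j$, while keeping the edge $ij$; thus each edge of $G$ becomes an edge of an $(n+1)$-gon. The polynomials $a_k(\mu)$, $k\ge -1$, are defined by $a_{-1}(\mu)=0$, $a_0(\mu)=1$, and $a_k(\mu)=2(1-\mu)a_{k-1}(\mu)-a_{k-2}(\mu)$ for $k\ge 1$. *)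

theory Defs
  imports
    "Graph_Theory.Pair_Digraph"
    "Graph_Theory.Digraph_Component"
    "Jordan_Normal_Form.Char_Poly"
    Complex_Main
begin

text \<open>Finite simple undirected graphs are the \<^locale>\<open>pair_graph\<close>s of \<^theory>\<open>Graph_Theory.Pair_Digraph\<close>:
  finite, loop-free, symmetric digraphs without parallel arcs. An undirected edge is
  represented by two opposite arcs, so edges are counted as two-element sets.\<close>

definition edge_set :: "'a pair_pre_digraph \<Rightarrow> 'a set set" where
  "edge_set G = {{u, v} | u v. (u, v) \<in> parcs G}"

definition bipartite :: "'a pair_pre_digraph \<Rightarrow> bool" where
  "bipartite G \<longleftrightarrow>
     (\<exists>X Y. pverts G = X \<union> Y \<and> X \<inter> Y = {} \<and> parcs G \<subseteq> X \<times> Y \<union> Y \<times> X)"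

subsection \<open>Normalized Laplacian\<close>

text \<open>Matrices have natural number indices, so they are formed with respect to an arbitrarily
  chosen enumeration of the vertices. Another enumeration conjugates all of them by a permutation
  matrix, which changes neither eigenvalues nor multiplicities.\<close>

definition vertex_list :: "'a pair_pre_digraph \<Rightarrow> 'a list" where
  "vertex_list H = (SOME xs. distinct xs \<and> set xs = pverts H)"

definition adjacency_matrix :: "'a pair_pre_digraph \<Rightarrow> real mat" where
  "adjacency_matrix H = mat (card (pverts H)) (card (pverts H))
     (\<lambda>(i, j). if (vertex_list H ! i, vertex_list H ! j) \<in> parcs H then 1 else 0)"

text \<open>In a symmetric digraph without parallel arcs the out-degree of a vertex is its degree in the
  underlying undirected graph.\<close>

definition inv_sqrt_degree_matrix :: "'a pair_pre_digraph \<Rightarrow> real mat" where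
  "inv_sqrt_degree_matrix H = mat_diag (card (pverts H))
     (\<lambda>i. 1 / sqrt (real (out_degree (with_proj H) (vertex_list H ! i))))"

definition normalized_laplacian :: "'a pair_pre_digraph \<Rightarrow> real mat" where
  "normalized_laplacian H = 1\<^sub>m (card (pverts H)) -
     inv_sqrt_degree_matrix H * adjacency_matrix H * inv_sqrt_degree_matrix H"

text \<open>Eigenvalues of a real matrix are taken in the complex numbers, and the multiplicity is
  the multiplicity as a root of the characteristic polynomial. It is \<open>0\<close> exactly for
  the numbers that are not eigenvalues.\<close>

definition is_eigenvalue :: "real mat \<Rightarrow> complex \<Rightarrow> bool" where
  "is_eigenvalue M \<mu> \<longleftrightarrow> eigenvalue (map_mat complex_of_real M) \<mu>"

definition eigenvalue_mult :: "real mat \<Rightarrow> complex \<Rightarrow> nat" where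
  "eigenvalue_mult M \<mu> = Polynomial.order \<mu> (char_poly (map_mat complex_of_real M))"

subsection \<open>Polygon graph\<close>

text \<open>The new vertex at distance \<open>k\<close> from \<open>i\<close>, and hence \<open>n - k\<close> from \<open>j\<close>, on the path attached to
  the edge \<open>ij\<close> is \<open>Inner {(i, k), (j, n - k)}\<close>. This name is symmetric in the two ends, so no
  orientation of the edges has to be chosen, and it determines the edge.\<close>

datatype 'a polygon_vertex = Orig 'a | Inner "('a \<times> nat) set"

definition path_vertex :: "nat \<Rightarrow> 'a \<Rightarrow> 'a \<Rightarrow> nat \<Rightarrow> 'a polygon_vertex" where
  "path_vertex n i j k =
     (if k = 0 then Orig i else if k = n then Orig j else Inner {(i, k), (j, n - k)})"

lemma path_vertex_rev:
  "0 < n \<Longrightarrow> k \<le> n \<Longrightarrow> path_vertex n j i (n - k) = path_vertex n i j k"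
  by (auto simp: path_vertex_def)

text \<open>By \<open>path_vertex_rev\<close>, the arcs opposite to the path arcs of \<open>(i, j)\<close> are the path arcs of
  \<open>(j, i)\<close>.\<close>

definition polygon_graph :: "nat \<Rightarrow> 'a pair_pre_digraph \<Rightarrow> 'a polygon_vertex pair_pre_digraph" where
  "polygon_graph n G =
     \<lparr> pverts = Orig ` pverts G \<union>
         {path_vertex n i j k | i j k. (i, j) \<in> parcs G \<and> 0 < k \<and> k < n},
       parcs = {(Orig i, Orig j) | i j. (i, j) \<in> parcs G} \<union>
         {(path_vertex n i j k, path_vertex n i j (k + 1)) | i j k. (i, j) \<in> parcs G \<and> k < n} \<rparr>"

subsection \<open>The polynomials $a_k$\<close>

text \<open>\<open>a_poly k \<mu>\<close> is the value $a_k(\mu)$, for $k \ge -1$; the value \<open>0\<close> at smaller indices is arbitrary.\<close>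

function a_poly :: "int \<Rightarrow> complex \<Rightarrow> complex" where
  "a_poly k \<mu> = (if k \<le> -1 then 0 else if k = 0 then 1
            else 2 * (1 - \<mu>) * a_poly (k - 1) \<mu> - a_poly (k - 2) \<mu>)"
  by pat_completeness auto
termination by (relation "measure (\<lambda>(k, \<mu>). nat (k + 1))") auto

declare a_poly.simps [simp del]

text \<open>The solutions \<open>x\<close> of the equation that relates an eigenvalue \<open>l\<close> of \<open>G\<close> to eigenvalues of the
  \<open>n\<close>-polygon graph; as division by zero yields zero, the denominator must be required to be
  nonzero.\<close>

definition eigenvalue_equation_roots :: "nat \<Rightarrow> complex \<Rightarrow> complex set" where
  "eigenvalue_equation_roots n l =
     {x. a_poly (int n div 2 - 1) x - a_poly (int n div 2 - 2) x \<noteq> 0 \<and>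
         1 - (a_poly (int n div 2) x - a_poly (int n div 2 - 1) x) /
             (a_poly (int n div 2 - 1) x - a_poly (int n div 2 - 2) x) = l}"

end

theory Submission
  imports
    Defs
    "HOL-Library.Function_Algebras"
    "Jordan_Normal_Form.Jordan_Normal_Form_Existence"
    "Jordan_Normal_Form.Jordan_Normal_Form_Uniqueness"
begin

text \<open>Conjugating by the square roots of the degrees turns $I - \mathcal{L}_H$ into the walk operator
  of $H$. So $\mu$ has the eigenspace of all functions $f$ on the vertices whose sum over the
  neighbours of each vertex $v$ is $x\,d_v f(v)$, where $x = 1 - \mu$. The matrix is real
  symmetric, hence diagonalizable, and the multiplicity of $\mu$ as a root of the characteristic
  polynomial is the dimension of this space (\<open>eigenvalue_mult_eq_dim\<close>). It remains to compute
  dimensions of function spaces for the polygon graph.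

  At the inner vertices of a path the eigenvalue equation is the recurrence of the Chebyshev
  polynomials of the second kind in $x$, so an eigenfunction is determined on a path by its values
  at the first two vertices: with $c_k = U_{k-1}(x) = a_{k-1}(\mu)$, its value at distance $k$ from
  $v$ is $c_k f_1 - c_{k-1} f(v)$. There are two cases.

  If $c_n \neq 0$, the values at the two ends determine the values on the path. Eliminating the inner
  vertices leaves the single equation $(c_n + 1) A f = c_{n+1} D f$ on the vertices of $G$, where
  $A$ and $D$ are the adjacency and the degree matrix
  (\<open>dim_walk_eigenspace_polygon_regular\<close>). For $n = 2m$ put $p = a_m(\mu)$, $q = a_{m-1}(\mu)$,
  $r = a_{m-2}(\mu)$. The addition formula gives $c_n + 1 = (p+q)(q-r)$ and $c_{n+1} = (p+q)(p-q)$.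
  So at a root of $p + q$ the equation is void and the multiplicity is the number of vertices of $G$.
  At the other $\mu$ it says that $(p-q)/(q-r)$ is the walk eigenvalue $1 - \lambda$ of $G$, with
  the same eigenspace.

  If $c_n = q(p - r) = 0$, the end values of a path are tied together by
  $f(w) = -\sigma f(v)$, where $\sigma = c_{n-1}$ is $-1$ at the roots of $q$ and $1$ at the roots of
  $p - r$. A summation over all arcs shows that $f$ then vanishes on $G$. What is
  left is one free amplitude per edge, antisymmetric or symmetric under reversal according to
  $\sigma$, with amplitudes around each vertex summing to zero
  (\<open>dim_walk_eigenspace_polygon_singular\<close>). This is the cycle space, or its unsigned
  analogue. The duality between arc sums and arc differences gives its dimension as the number
  of edges minus the number of vertices plus the dimension of the walk eigenspace of $G$ at
  $-\sigma$ (\<open>dim_circulations\<close>); by connectedness the latter is $1$, except that it is $0$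
  if $\sigma = 1$ and $G$ is not bipartite.

  Finally, the equation $p - q = (1 - \lambda)(q - r)$ has exactly $m$ solutions for
  $0 < \lambda < 2$, since its sign alternates at the $m + 1$ points $x = \cos(j\pi/m)$
  (\<open>cheb_combination_roots\<close>).\<close>

section \<open>Dimensions of spaces of complex functions\<close>

definition fscale :: "complex \<Rightarrow> ('v \<Rightarrow> complex) \<Rightarrow> 'v \<Rightarrow> complex" where
  "fscale c f = (\<lambda>x. c * f x)"

lemma fscale_apply [simp]: "fscale c f x = c * f x"
  by (simp add: fscale_def)

interpretation fs: vector_space fscale
  by unfold_locales (simp_all add: fun_eq_iff algebra_simps)

interpretation fsp: vector_space_pair fscale fscale ..

abbreviation flinear :: "(('v \<Rightarrow> complex) \<Rightarrow> ('w \<Rightarrow> complex)) \<Rightarrow> bool" where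
  "flinear \<equiv> Vector_Spaces.linear fscale fscale"

lemma flinearI:
  assumes "\<And>f g. \<Phi> (f + g) = \<Phi> f + \<Phi> g" "\<And>c f. \<Phi> (fscale c f) = fscale c (\<Phi> f)"
  shows "flinear \<Phi>"
  unfolding Vector_Spaces.linear_iff using assms by (auto intro: fs.vector_space_axioms)

lemma sum_fun_apply: "(\<Sum>i\<in>I. F i) x = (\<Sum>i\<in>I. F i x)" for F :: "'i \<Rightarrow> 'v \<Rightarrow> complex"
  by (induction I rule: infinite_finite_induct) auto

lemma inj_on_subspace:
  assumes "flinear \<Phi>" "fs.subspace S" "\<And>f. f \<in> S \<Longrightarrow> \<Phi> f = 0 \<Longrightarrow> f = 0"
  shows "inj_on \<Phi> S"
proof (rule inj_onI)
  fix f g assume "f \<in> S" "g \<in> S" "\<Phi> f = \<Phi> g"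
  then have "f - g \<in> S" "\<Phi> (f - g) = 0"
    using assms(2) fsp.linear_diff[OF assms(1)] by (auto intro: fs.subspace_diff)
  then show "f = g" using assms(3) by force
qed

lemma dim_linear_image:
  assumes "flinear \<Phi>" "fs.subspace S" "\<And>f. f \<in> S \<Longrightarrow> \<Phi> f = 0 \<Longrightarrow> f = 0"
  shows "fs.dim (\<Phi> ` S) = fs.dim S"
proof -
  note inj = inj_on_subspace[OF assms]
  obtain B where B: "B \<subseteq> S" "fs.independent B" "S \<subseteq> fs.span B" "card B = fs.dim S"
    using fs.basis_exists by blast
  have span: "fs.span B = S"
    using B assms(2) by (meson fs.span_minimal subset_antisym)
  have "fs.independent (\<Phi> ` B)"
    using fsp.linear_independent_injective_image[OF assms(1) B(2)] inj span by simp
  moreover have "fs.span (\<Phi> ` B) = \<Phi> ` S"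
    using fsp.linear_span_image[OF assms(1)] span by simp
  ultimately have "fs.dim (\<Phi> ` S) = card (\<Phi> ` B)"
    by (metis fs.dim_eq_card fs.dim_span)
  also have "\<dots> = card B" using inj B(1) by (meson card_image inj_on_subset)
  finally show ?thesis using B by simp
qed

lemma dim_linear_bij:
  assumes "flinear \<Phi>" "fs.subspace S"
    and "\<And>f. f \<in> S \<Longrightarrow> \<Phi> f \<in> T" "\<And>f. f \<in> S \<Longrightarrow> \<Phi> f = 0 \<Longrightarrow> f = 0"
    and "\<And>g. g \<in> T \<Longrightarrow> \<exists>f\<in>S. \<Phi> f = g"
  shows "fs.dim S = fs.dim T"
proof -
  have "\<Phi> ` S = T" using assms(3,5) by force
  then show ?thesis using dim_linear_image[OF assms(1,2,4)] by simp
qed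

definition finite_dim :: "('v \<Rightarrow> complex) set \<Rightarrow> bool" where
  "finite_dim S \<longleftrightarrow> (\<exists>B. finite B \<and> S \<subseteq> fs.span B)"

lemma finite_dim_subset: "finite_dim T \<Longrightarrow> S \<subseteq> T \<Longrightarrow> finite_dim S"
  unfolding finite_dim_def by blast

lemma finite_dim_image:
  assumes "flinear \<Phi>" "finite_dim S" shows "finite_dim (\<Phi> ` S)"
proof -
  obtain B where "finite B" "S \<subseteq> fs.span B" using assms(2) unfolding finite_dim_def by blast
  then have "finite (\<Phi> ` B)" "\<Phi> ` S \<subseteq> fs.span (\<Phi> ` B)"
    using fsp.linear_span_image[OF assms(1), of B] by auto
  then show ?thesis unfolding finite_dim_def by blast
qed

lemma finite_dim_independent:
  assumes "finite_dim S" "fs.independent B" "B \<subseteq> S" shows "finite B"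
  using assms fs.independent_span_bound[of _ B] unfolding finite_dim_def by blast

lemma dim_mono:
  assumes "finite_dim T" "S \<subseteq> T"
  shows "fs.dim S \<le> fs.dim T"
proof -
  obtain B where B: "B \<subseteq> T" "fs.independent B" "T \<subseteq> fs.span B" "card B = fs.dim T"
    using fs.basis_exists by blast
  have "finite B" using finite_dim_independent assms(1) B by blast
  then show ?thesis using fs.dim_le_card[of S B] B assms(2) by auto
qed

text \<open>The ambient function space may have infinite dimension; only \<open>S\<close> is finite-dimensional. A basis of
  the kernel extends to a basis of \<open>S\<close>, and the map is injective on the span of the new basis
  vectors.\<close>

lemma rank_nullity:
  assumes lin: "flinear \<Phi>" and S: "fs.subspace S" "finite_dim S"
  shows "fs.dim S = fs.dim {f \<in> S. \<Phi> f = 0} + fs.dim (\<Phi> ` S)"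
proof -
  let ?K = "{f \<in> S. \<Phi> f = 0}"
  have subK: "fs.subspace ?K"
    unfolding fs.subspace_def
    using S(1) fsp.linear_0[OF lin] fsp.linear_add[OF lin] fsp.linear_scale[OF lin]
    by (auto simp: fs.subspace_def fs.scale_zero_right)
  obtain K where K: "K \<subseteq> ?K" "fs.independent K" "?K \<subseteq> fs.span K" "card K = fs.dim ?K"
    using fs.basis_exists by blast
  have "K \<subseteq> S" using K by auto
  then obtain B where B: "K \<subseteq> B" "B \<subseteq> S" "fs.independent B" "S \<subseteq> fs.span B"
    using fs.maximal_independent_subset_extend K(2) by metis
  have finB: "finite B" using finite_dim_independent S(2) B by blast
  let ?C = "B - K"
  have spanB: "fs.span B = S" using B S(1) by (meson fs.span_minimal subset_antisym)
  have spanK: "fs.span K = ?K" using K subK by (meson fs.span_minimal subset_antisym)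
  have indep: "fs.independent (\<Phi> ` ?C)" and inj: "inj_on \<Phi> ?C"
  proof -
    \<comment> \<open>Such an \<open>f\<close> lies in the span of \<open>K\<close> and in that of its complement \<open>?C\<close> in the basis, so all its coordinates vanish.\<close>
    have "f = 0" if f: "f \<in> fs.span ?C" "\<Phi> f = 0" for f
    proof -
      have "fs.span ?C \<subseteq> S" using spanB fs.span_mono[of ?C B] by auto
      then have "f \<in> fs.span K" using f spanK by blast
      then have "fs.representation B f = fs.representation K f"
        using fs.representation_extend[OF B(3) _ B(1)] by simp
      moreover have "fs.representation B f = fs.representation ?C f"
        using fs.representation_extend[OF B(3) f(1)] by simp
      ultimately have "fs.representation B f v = 0" for v
        using fs.representation_ne_zero[of K f v] fs.representation_ne_zero[of ?C f v] by auto
      moreover have "f \<in> fs.span B" using fs.span_mono[of ?C B] f(1) by blast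
      ultimately show "f = 0"
        using fs.sum_nonzero_representation_eq[of B f] B(3) by simp
    qed
    then have "inj_on \<Phi> (fs.span ?C)"
      using inj_on_subspace[OF lin fs.subspace_span] by blast
    then show "fs.independent (\<Phi> ` ?C)" "inj_on \<Phi> ?C"
      using fsp.linear_independent_injective_image[OF lin] B(3) fs.independent_mono[of B ?C]
      by (auto intro: inj_on_subset[OF _ fs.span_superset])
  qed
  have "\<Phi> ` S \<subseteq> fs.span (\<Phi> ` ?C)"
  proof
    fix g assume "g \<in> \<Phi> ` S"
    then have "g \<in> fs.span (\<Phi> ` B)" using spanB fsp.linear_span_image[OF lin] by simp
    moreover have "\<Phi> ` B \<subseteq> insert 0 (\<Phi> ` ?C)" using K(1) by auto
    ultimately show "g \<in> fs.span (\<Phi> ` ?C)"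
      using fs.span_mono fs.span_insert_0 by blast
  qed
  moreover have "\<Phi> ` ?C \<subseteq> \<Phi> ` S" using B(2) by auto
  ultimately have "fs.dim (\<Phi> ` S) = card (\<Phi> ` ?C)"
    using indep by (simp add: fs.basis_card_eq_dim)
  also have "\<dots> = card ?C" using inj by (rule card_image)
  also have "\<dots> = card B - card K" using B(1) finB by (simp add: card_Diff_subset finite_subset)
  finally have "fs.dim (\<Phi> ` S) + card K = card B"
    using card_mono[OF finB B(1)] by simp
  moreover have "card B = fs.dim S" using B fs.basis_card_eq_dim by blast
  ultimately show ?thesis using K(4) by simp
qed

definition supported_on :: "'v set \<Rightarrow> ('v \<Rightarrow> complex) set" where
  "supported_on X = {f. \<forall>x. x \<notin> X \<longrightarrow> f x = 0}"

lemma subspace_supported_on: "fs.subspace (supported_on X)"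
  by (auto simp: fs.subspace_def supported_on_def)

lemma supported_on_finite_dim:
  assumes "finite X"
  shows "finite_dim (supported_on X)" and "fs.dim (supported_on X) = card X"
proof -
  define e :: "'a \<Rightarrow> 'a \<Rightarrow> complex" where "e = (\<lambda>x y. if y = x then 1 else 0)"
  have inj: "inj e"
    unfolding inj_def e_def by (metis zero_neq_one)
  have sum_e: "(\<Sum>x\<in>X. fscale (c x) (e x)) y = (if y \<in> X then c y else 0)" for c y
    using assms by (auto simp: sum_fun_apply e_def if_distrib cong: if_cong)
  have ind: "fs.independent (e ` X)"
  proof (rule fs.independent_if_scalars_zero)
    show "finite (e ` X)" using assms by simp
  next
    fix c b assume "(\<Sum>b\<in>e ` X. fscale (c b) b) = 0" and b: "b \<in> e ` X"
    then have *: "(\<Sum>x\<in>X. fscale (c (e x)) (e x)) = 0"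
      using inj by (subst (asm) sum.reindex) (auto intro: inj_on_subset)
    obtain x where x: "x \<in> X" "b = e x" using b by auto
    have "c (e x) = (\<Sum>x\<in>X. fscale (c (e x)) (e x)) x" using sum_e[of "\<lambda>x. c (e x)" x] x by simp
    then show "c b = 0" using * x by simp
  qed
  have sp: "supported_on X \<subseteq> fs.span (e ` X)"
  proof
    fix f assume f: "f \<in> supported_on X"
    have "f = (\<Sum>x\<in>X. fscale (f x) (e x))"
      using f by (auto simp: fun_eq_iff sum_e supported_on_def)
    also have "\<dots> \<in> fs.span (e ` X)"
      by (intro fs.span_sum fs.span_scale fs.span_base) auto
    finally show "f \<in> fs.span (e ` X)" .
  qed
  have sub: "e ` X \<subseteq> supported_on X" by (auto simp: supported_on_def e_def)
  show "finite_dim (supported_on X)" using sp assms unfolding finite_dim_def by blast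
  have "fs.dim (supported_on X) = card (e ` X)"
    using fs.basis_card_eq_dim[OF sub sp ind] by simp
  also have "\<dots> = card X" using inj by (simp add: card_image inj_on_subset)
  finally show "fs.dim (supported_on X) = card X" .
qed

lemma dim_zero [simp]: "fs.dim {0} = 0"
  using fs.dim_eq_card[of "{}" "{0}"] fs.independent_empty by simp

lemma dim_multiples:
  assumes "g \<noteq> 0" shows "fs.dim (range (\<lambda>c. fscale c g)) = 1"
proof -
  have "range (\<lambda>c. fscale c g) = fs.span {g}"
    using fs.span_singleton[of g] by auto
  then show ?thesis
    using fs.dim_span_eq_card_independent[of "{g}"] assms by simp
qed

text \<open>The two conditions on kernels hold for any pair of adjoint maps with respect to positive definite
  forms. They say that each map is injective on the image of the other, so both have the same rank,
  and rank-nullity for both maps gives the equation.\<close>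

lemma dim_kernel_adjoint:
  assumes L: "flinear L" and M: "flinear M"
    and S: "fs.subspace S" "finite_dim S" and W: "fs.subspace W" "finite_dim W"
    and LS: "L ` S \<subseteq> W" and MW: "M ` W \<subseteq> S"
    and LM: "\<And>w. w \<in> W \<Longrightarrow> L (M w) = 0 \<Longrightarrow> M w = 0"
    and ML0: "\<And>s. s \<in> S \<Longrightarrow> M (L s) = 0 \<Longrightarrow> L s = 0"
  shows "fs.dim {s \<in> S. L s = 0} + fs.dim W = fs.dim {w \<in> W. M w = 0} + fs.dim S"
proof -
  have "fs.dim (L ` S) = fs.dim (M ` L ` S)"
    using dim_linear_image[OF M fsp.linear_subspace_image[OF L S(1)]] ML0 by force
  also have "\<dots> \<le> fs.dim (M ` W)"
    using LS by (intro dim_mono finite_dim_image[OF M W(2)]) auto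
  finally have 1: "fs.dim (L ` S) \<le> fs.dim (M ` W)" .
  have "fs.dim (M ` W) = fs.dim (L ` M ` W)"
    using dim_linear_image[OF L fsp.linear_subspace_image[OF M W(1)]] LM by force
  also have "\<dots> \<le> fs.dim (L ` S)"
    using MW by (intro dim_mono finite_dim_image[OF L S(2)]) auto
  finally have "fs.dim (L ` S) = fs.dim (M ` W)" using 1 by simp
  then show ?thesis
    using rank_nullity[OF L S] rank_nullity[OF M W] by simp
qed

section \<open>Multiplicities of eigenvalues of symmetric matrices\<close>

text \<open>Extension by zero, which makes vectors of length \<open>n\<close> elements of a function space.\<close>

definition vec_fun :: "nat \<Rightarrow> complex vec \<Rightarrow> nat \<Rightarrow> complex" where
  "vec_fun n v = (\<lambda>i. if i < n then v $ i else 0)"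

lemma kernel_dim_eq_dim:
  fixes A :: "complex mat"
  assumes A: "A \<in> carrier_mat n n"
  shows "kernel_dim A = fs.dim (vec_fun n ` mat_kernel A)"
proof -
  let ?B = "gauss_jordan_single A"
  from gauss_jordan_single[OF A refl]
  obtain P Q where AB: "?B = P * A" and QP: "Q * P = 1\<^sub>m n"
    and P: "P \<in> carrier_mat n n" and Q: "Q \<in> carrier_mat n n"
    and B: "?B \<in> carrier_mat n n" and row: "row_echelon_form ?B" by auto
  have ker: "mat_kernel ?B = mat_kernel A"
    using mat_kernel_mult_eq[OF A P Q QP] AB by simp
  interpret K: kernel n n A by (unfold_locales, rule A)
  obtain X where basis: "K.basis X" and finX: "finite X" and X: "X \<subseteq> mat_kernel A"
    using find_base_vectors(1,3)[OF row B] unfolding ker by auto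
  have index: "vec_fun n (K.lincomb a Y) = (\<Sum>v\<in>Y. fscale (a v) (vec_fun n v))"
    if "Y \<subseteq> X" for a Y
    using K.lincomb_index[of _ Y a] that X
    by (auto simp: fun_eq_iff sum_fun_apply vec_fun_def)
  have inj: "inj_on (vec_fun n) (mat_kernel A)"
  proof (rule inj_onI)
    fix v w assume vw: "v \<in> mat_kernel A" "w \<in> mat_kernel A" "vec_fun n v = vec_fun n w"
    then have "dim_vec v = n" "dim_vec w = n" using mat_kernelD[OF A] by auto
    moreover have "v $ i = w $ i" if "i < n" for i
      using fun_cong[OF vw(3), of i] that by (simp add: vec_fun_def)
    ultimately show "v = w" by (intro eq_vecI) auto
  qed
  have zero: "0\<^sub>v n \<in> mat_kernel A" using A by (auto intro!: mat_kernelI)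
  have "fs.independent (vec_fun n ` X)"
  proof (rule fs.independent_if_scalars_zero)
    show "finite (vec_fun n ` X)" using finX by simp
  next
    fix c f assume "(\<Sum>f\<in>vec_fun n ` X. fscale (c f) f) = 0" and f: "f \<in> vec_fun n ` X"
    then have "(\<Sum>v\<in>X. fscale (c (vec_fun n v)) (vec_fun n v)) = 0"
      using inj_on_subset[OF inj X] by (simp add: sum.reindex)
    then have "vec_fun n (K.lincomb (\<lambda>v. c (vec_fun n v)) X) = vec_fun n (0\<^sub>v n)"
      unfolding index[OF order_refl] by (auto simp: vec_fun_def fun_eq_iff)
    moreover have "K.lincomb (\<lambda>v. c (vec_fun n v)) X \<in> mat_kernel A"
      using K.Ker.lincomb_closed[OF X] by simp
    ultimately have l0: "K.lincomb (\<lambda>v. c (vec_fun n v)) X = 0\<^sub>v n"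
      using inj zero by (auto dest: inj_onD)
    have "\<not> K.lin_dep X" using basis unfolding K.Ker.basis_def by simp
    then show "c f = 0" using f l0 finX unfolding K.Ker.lin_dep_def by auto
  qed
  moreover have "vec_fun n ` mat_kernel A \<subseteq> fs.span (vec_fun n ` X)"
  proof safe
    fix v assume "v \<in> mat_kernel A"
    then have "v \<in> K.span X" using basis unfolding K.Ker.basis_def by simp
    then obtain a Y where "Y \<subseteq> X" "v = K.lincomb a Y"
      unfolding K.Ker.span_def by auto
    then have "vec_fun n v = (\<Sum>v\<in>Y. fscale (a v) (vec_fun n v))" using index by simp
    also have "\<dots> \<in> fs.span (vec_fun n ` X)"
      using \<open>Y \<subseteq> X\<close> by (intro fs.span_sum fs.span_scale fs.span_base) auto
    finally show "vec_fun n v \<in> fs.span (vec_fun n ` X)" .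
  qed
  ultimately have "fs.dim (vec_fun n ` mat_kernel A) = card (vec_fun n ` X)"
    using X by (intro fs.basis_card_eq_dim[symmetric]) auto
  also have "\<dots> = card X" using inj_on_subset[OF inj X] by (rule card_image)
  also have "\<dots> = kernel_dim A" using K.Ker.dim_basis[OF finX basis] by simp
  finally show ?thesis ..
qed

text \<open>In the application, \<open>ns\<close> lists the sizes of the Jordan blocks of an eigenvalue, and the two sums of
  minima are the dimensions of the kernels of the square and of the first power; if they agree, no
  block is larger than 1.\<close>

lemma sum_list_eq_if_min_eq:
  assumes "\<forall>n\<in>set ns. 0 < n" "(\<Sum>n\<leftarrow>ns. min 2 n) = (\<Sum>n\<leftarrow>ns. min 1 n)"
  shows "sum_list ns = (\<Sum>n\<leftarrow>ns. min 1 (n::nat))"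
  using assms
proof (induction ns)
  case (Cons n ns)
  have "(\<Sum>n\<leftarrow>ns. min 1 n) \<le> (\<Sum>n\<leftarrow>ns. min 2 n)" by (intro sum_list_mono) auto
  with Cons.prems have "min 2 n = min 1 n" "(\<Sum>n\<leftarrow>ns. min 2 n) = (\<Sum>n\<leftarrow>ns. min 1 n)"
    by auto
  then show ?case using Cons by (auto simp: min_def split: if_splits)
qed simp

text \<open>Squaring the matrix does not enlarge the kernel, so all Jordan blocks of \<open>\<mu>\<close> have size 1, and
  algebraic and geometric multiplicity agree.\<close>

lemma order_char_poly_eq_kernel_dim:
  fixes A :: "complex mat"
  assumes A: "A \<in> carrier_mat n n"
    and semisimple: "mat_kernel (char_matrix A \<mu> * char_matrix A \<mu>) = mat_kernel (char_matrix A \<mu>)"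
  shows "Polynomial.order \<mu> (char_poly A) = kernel_dim (char_matrix A \<mu>)"
proof -
  let ?C = "char_matrix A \<mu>"
  have C: "?C \<in> carrier_mat n n" using A by simp
  obtain n_as where jnf: "jordan_nf A n_as"
    using char_poly_factorized[OF A] jordan_nf_exists[OF A] by blast
  let ?ns = "map fst (filter (\<lambda>na. snd na = \<mu>) n_as)"
  have pos: "\<forall>n\<in>set ?ns. 0 < n"
    using jnf unfolding jordan_nf_def by (auto intro!: gr0I simp: image_iff)
  have filt: "[(n, e)\<leftarrow>n_as. e = \<mu>] = filter (\<lambda>na. snd na = \<mu>) n_as"
    by (intro filter_cong) auto
  have dims: "dim_gen_eigenspace A \<mu> k = (\<Sum>n\<leftarrow>?ns. min k n)" for k
    using dim_gen_eigenspace[OF jnf, of \<mu> k] unfolding filt .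
  have "?C ^\<^sub>m 2 = ?C * ?C" "?C ^\<^sub>m 1 = ?C"
    using C by (simp_all add: numeral_2_eq_2)
  then have "dim_gen_eigenspace A \<mu> 2 = kernel_dim ?C" "dim_gen_eigenspace A \<mu> 1 = kernel_dim ?C"
    using semisimple C by (simp_all add: dim_gen_eigenspace_def kernel_dim_def)
  then show ?thesis
    using sum_list_eq_if_min_eq[OF pos] jordan_nf_order[OF jnf, of \<mu>] unfolding dims by simp
qed

lemma sum_mult_cnj_eq_0:
  assumes "finite A" "(\<Sum>a\<in>A. f a * cnj (f a)) = 0" "a \<in> A"
  shows "f a = 0"
proof -
  have "(\<Sum>a\<in>A. f a * cnj (f a)) = of_real (\<Sum>a\<in>A. (cmod (f a))\<^sup>2)"
    by (simp add: complex_norm_square[symmetric] flip: of_real_sum of_real_power)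
  then have "(\<Sum>a\<in>A. (cmod (f a))\<^sup>2) = 0" using assms(2) by (metis of_real_eq_0_iff)
  then show ?thesis using assms(1,3) by (subst (asm) sum_nonneg_eq_0_iff) auto
qed

lemma hermitian_form_symmetric:
  fixes M :: "nat \<Rightarrow> nat \<Rightarrow> real"
  assumes "\<And>i j. i < n \<Longrightarrow> j < n \<Longrightarrow> M i j = M j i"
  shows "(\<Sum>i<n. (\<Sum>j<n. of_real (M i j) * f j) * cnj (g i)) =
         (\<Sum>i<n. f i * cnj (\<Sum>j<n. of_real (M i j) * g j))"
proof -
  have "(\<Sum>i<n. (\<Sum>j<n. of_real (M i j) * f j) * cnj (g i)) =
        (\<Sum>i<n. \<Sum>j<n. of_real (M i j) * f j * cnj (g i))"
    by (simp add: sum_distrib_right)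
  also have "\<dots> = (\<Sum>j<n. \<Sum>i<n. of_real (M i j) * f j * cnj (g i))"
    by (rule sum.swap)
  also have "\<dots> = (\<Sum>j<n. \<Sum>i<n. f j * (of_real (M j i) * cnj (g i)))"
    using assms by (intro sum.cong) (auto simp: mult_ac)
  finally show ?thesis by (simp add: sum_distrib_left)
qed

text \<open>A real symmetric matrix has no generalized eigenvectors of order two: if \<open>w\<close>, the image of \<open>v\<close>
  under the matrix minus \<open>\<mu>\<close>, is an eigenvector for \<open>\<mu>\<close>, then \<open>\<mu>\<close> is real, and moving the symmetric
  operator to the other factor in the inner product of \<open>w\<close> with itself gives zero.\<close>

lemma symmetric_eigenvalue_semisimple:
  fixes M :: "nat \<Rightarrow> nat \<Rightarrow> real" and v w :: "nat \<Rightarrow> complex"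
  assumes sym: "\<And>i j. i < n \<Longrightarrow> j < n \<Longrightarrow> M i j = M j i"
    and w: "\<And>i. i < n \<Longrightarrow> w i = (\<Sum>j<n. of_real (M i j) * v j) - \<mu> * v i"
    and Mw: "\<And>i. i < n \<Longrightarrow> (\<Sum>j<n. of_real (M i j) * w j) = \<mu> * w i"
    and i: "i < n"
  shows "w i = 0"
proof (rule ccontr)
  assume nz: "w i \<noteq> 0"
  define T where "T = (\<lambda>f i. \<Sum>j<n. of_real (M i j) * f j :: complex)"
  have T: "(\<Sum>i<n. T f i * cnj (g i)) = (\<Sum>i<n. f i * cnj (T g i))" for f g
    unfolding T_def using sym by (rule hermitian_form_symmetric)
  have Tv: "T v i = w i + \<mu> * v i" and Tw: "T w i = \<mu> * w i" if "i < n" for i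
    using w[OF that] Mw[OF that] by (simp_all add: T_def)
  let ?W = "\<Sum>i<n. w i * cnj (w i)" and ?V = "\<Sum>i<n. v i * cnj (w i)"
  have W: "?W \<noteq> 0" using sum_mult_cnj_eq_0[of "{..<n}" w i] i nz by auto
  have "\<mu> * ?W = cnj \<mu> * ?W"
    using T[of w w] by (simp add: Tw sum_distrib_left mult_ac)
  then have real: "cnj \<mu> = \<mu>" using W by simp
  have "?W + \<mu> * ?V = \<mu> * ?V"
    using T[of v w] by (simp add: Tv Tw real sum_distrib_left sum.distrib algebra_simps)
  then show False using W by simp
qed

lemma order_char_poly_symmetric:
  fixes M :: "nat \<Rightarrow> nat \<Rightarrow> real"
  assumes sym: "\<And>i j. i < n \<Longrightarrow> j < n \<Longrightarrow> M i j = M j i"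
  shows "Polynomial.order \<mu> (char_poly (map_mat complex_of_real (mat n n (\<lambda>(i, j). M i j)))) =
    fs.dim {f \<in> supported_on {..<n}. \<forall>i<n. (\<Sum>j<n. of_real (M i j) * f j) = \<mu> * f i}"
proof -
  define A where "A = map_mat complex_of_real (mat n n (\<lambda>(i, j). M i j))"
  let ?C = "char_matrix A \<mu>"
  have A: "A \<in> carrier_mat n n" by (simp add: A_def)
  then have C: "?C \<in> carrier_mat n n" by simp
  have Cv: "(?C *\<^sub>v v) $ i = (\<Sum>j<n. of_real (M i j) * v $ j) - \<mu> * v $ i"
    if "v \<in> carrier_vec n" "i < n" for v i
  proof -
    have "(?C *\<^sub>v v) $ i = (\<Sum>j<n. (of_real (M i j) + (if i = j then - \<mu> else 0)) * v $ j)"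
      using that A by (auto simp: A_def char_matrix_def scalar_prod_def lessThan_atLeast0 intro!: sum.cong)
    also have "\<dots> = (\<Sum>j<n. of_real (M i j) * v $ j) + (\<Sum>j<n. if i = j then - \<mu> * v $ j else 0)"
      unfolding sum.distrib[symmetric] by (intro sum.cong) (auto simp: algebra_simps)
    finally show ?thesis using that by simp
  qed
  have ker: "v \<in> mat_kernel ?C \<longleftrightarrow>
      v \<in> carrier_vec n \<and> (\<forall>i<n. (\<Sum>j<n. of_real (M i j) * v $ j) = \<mu> * v $ i)" for v
  proof -
    have eq: "?C *\<^sub>v v = 0\<^sub>v n \<longleftrightarrow> (\<forall>i<n. (?C *\<^sub>v v) $ i = 0)"
      using C by (simp add: vec_eq_iff del: index_mult_mat_vec)
    show ?thesis unfolding mat_kernel[OF C] using Cv by (auto simp: eq simp del: index_mult_mat_vec)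
  qed
  have "mat_kernel (?C * ?C) = mat_kernel ?C"
  proof
    show "mat_kernel ?C \<subseteq> mat_kernel (?C * ?C)" by (rule mat_kernel_mult_subset[OF C C])
    show "mat_kernel (?C * ?C) \<subseteq> mat_kernel ?C"
    proof
      fix v assume "v \<in> mat_kernel (?C * ?C)"
      then have v: "v \<in> carrier_vec n" and "(?C * ?C) *\<^sub>v v = 0\<^sub>v n"
        using mat_kernelD[of "?C * ?C" n n v] C by auto
      then have 0: "?C *\<^sub>v (?C *\<^sub>v v) = 0\<^sub>v n" using C by simp
      define w where "w = ?C *\<^sub>v v"
      have "w \<in> carrier_vec n" using C v by (simp add: w_def)
      then have "w \<in> mat_kernel ?C" using 0 C by (auto simp: w_def intro!: mat_kernelI)
      then have "w $ i = 0" if "i < n" for i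
        using symmetric_eigenvalue_semisimple[of n M "\<lambda>i. w $ i" "\<lambda>i. v $ i" \<mu> i] sym that v Cv
        unfolding ker by (simp add: w_def)
      then have "?C *\<^sub>v v = 0\<^sub>v n" using C by (auto intro!: eq_vecI simp: w_def)
      then show "v \<in> mat_kernel ?C" using v C by (auto intro!: mat_kernelI)
    qed
  qed
  then have "Polynomial.order \<mu> (char_poly A) = kernel_dim ?C"
    by (rule order_char_poly_eq_kernel_dim[OF A])
  also have "\<dots> = fs.dim (vec_fun n ` mat_kernel ?C)" by (rule kernel_dim_eq_dim[OF C])
  also have "vec_fun n ` mat_kernel ?C =
      {f \<in> supported_on {..<n}. \<forall>i<n. (\<Sum>j<n. of_real (M i j) * f j) = \<mu> * f i}" (is "_ = ?E")
  proof
    show "vec_fun n ` mat_kernel ?C \<subseteq> ?E"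
      by (auto simp: ker vec_fun_def supported_on_def)
    show "?E \<subseteq> vec_fun n ` mat_kernel ?C"
    proof
      fix f assume f: "f \<in> ?E"
      then have "f = vec_fun n (vec n f)" by (auto simp: vec_fun_def supported_on_def)
      moreover have "vec n f \<in> mat_kernel ?C" using f by (simp add: ker)
      ultimately show "f \<in> vec_fun n ` mat_kernel ?C" by blast
    qed
  qed
  finally show ?thesis unfolding A_def .
qed

section \<open>The normalized Laplacian and the neighbour-sum operator\<close>

definition nbrs :: "'a pair_pre_digraph \<Rightarrow> 'a \<Rightarrow> 'a set" where
  "nbrs H v = {w. (v, w) \<in> parcs H}"

text \<open>The eigenspace for \<open>x\<close> of the random walk operator $D^{-1}A$, with the degrees
  cleared from the denominator.\<close>

definition walk_eigenspace :: "'a pair_pre_digraph \<Rightarrow> complex \<Rightarrow> ('a \<Rightarrow> complex) set" where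
  "walk_eigenspace H x = {f \<in> supported_on (pverts H).
     \<forall>v\<in>pverts H. (\<Sum>w\<in>nbrs H v. f w) = x * of_nat (card (nbrs H v)) * f v}"

lemma subspace_walk_eigenspace: "fs.subspace (walk_eigenspace H x)"
  by (auto simp: fs.subspace_def walk_eigenspace_def supported_on_def sum.distrib
      algebra_simps simp flip: sum_distrib_left)

lemma (in pair_graph) nbrs_subset: "nbrs G v \<subseteq> pverts G"
  by (auto simp: nbrs_def intro: in_arcsD2)

lemma (in pair_graph) finite_nbrs [simp]: "finite (nbrs G v)"
  using nbrs_subset pair_finite_verts by (rule finite_subset)

lemma out_degree_eq_card_nbrs: "out_degree (with_proj H) v = card (nbrs H v)"
proof -
  have "out_arcs (with_proj H) v = Pair v ` nbrs H v"
    by (auto simp: out_arcs_def nbrs_def)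
  then show ?thesis by (simp add: out_degree_def card_image inj_on_def)
qed

lemma (in pair_graph) vertex_list:
  "distinct (vertex_list G)" "set (vertex_list G) = pverts G"
  using someI_ex[OF finite_distinct_list[OF pair_finite_verts]]
  unfolding vertex_list_def by (auto simp: conj_commute)

lemma (in pair_graph) normalized_laplacian_entries:
  defines "s \<equiv> \<lambda>i. 1 / sqrt (real (card (nbrs G (vertex_list G ! i))))"
  shows "normalized_laplacian G = mat (card (pverts G)) (card (pverts G))
    (\<lambda>(i, j). (if i = j then 1 else 0) -
       s i * (if (vertex_list G ! i, vertex_list G ! j) \<in> parcs G then 1 else 0) * s j)"
proof -
  let ?N = "card (pverts G)"
  have D: "inv_sqrt_degree_matrix G = mat_diag ?N s"
    by (simp add: inv_sqrt_degree_matrix_def s_def out_degree_eq_card_nbrs)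
  have A: "adjacency_matrix G \<in> carrier_mat ?N ?N" by (simp add: adjacency_matrix_def)
  have "mat_diag ?N s * adjacency_matrix G * mat_diag ?N s =
      mat ?N ?N (\<lambda>(i, j). s i * adjacency_matrix G $$ (i, j) * s j)"
    using A by (subst mat_diag_mult_left[OF A], subst mat_diag_mult_right) auto
  then show ?thesis
    unfolding normalized_laplacian_def D
    by (intro eq_matI) (auto simp: adjacency_matrix_def)
qed

text \<open>Multiplying a function on the vertices by the square roots of the degrees carries the walk
  eigenspace to the eigenspace of the symmetric matrix, where geometric and algebraic multiplicity
  coincide.\<close>

lemma (in pair_graph) eigenvalue_mult_eq_dim:
  assumes deg: "\<And>v. v \<in> pverts G \<Longrightarrow> nbrs G v \<noteq> {}"
  shows "eigenvalue_mult (normalized_laplacian G) \<mu> = fs.dim (walk_eigenspace G (1 - \<mu>))"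
proof -
  define N where "N = card (pverts G)"
  define xs where "xs = vertex_list G"
  define r where "r = (\<lambda>v. complex_of_real (sqrt (real (card (nbrs G v)))))"
  define s where "s = (\<lambda>i. 1 / sqrt (real (card (nbrs G (xs ! i)))))"
  define M where "M = (\<lambda>i j. (if i = j then 1 else 0) -
    s i * (if (xs ! i, xs ! j) \<in> parcs G then 1 else 0) * s j)"
  have xs: "distinct xs" "set xs = pverts G" using vertex_list by (simp_all add: xs_def)
  then have len: "length xs = N" using distinct_card by (fastforce simp: N_def)
  have bij: "bij_betw ((!) xs) {..<N} (pverts G)"
    using xs len by (auto intro!: bij_betw_nth)
  have in_verts: "xs ! i \<in> pverts G" if "i < N" for i using that xs len nth_mem by blast
  have r2: "r v * r v = of_nat (card (nbrs G v))" for v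
    by (simp add: r_def flip: of_real_mult)
  have r_nz: "r v \<noteq> 0" if "v \<in> pverts G" for v
    using deg[OF that] by (simp add: r_def)
  have s_r: "of_real (s i) = 1 / r (xs ! i)" for i
    by (simp add: s_def r_def)
  have sym: "M i j = M j i" if "i < N" "j < N" for i j
    using arcs_symmetric by (auto simp: M_def)
  let ?E = "{g \<in> supported_on {..<N}. \<forall>i<N. (\<Sum>j<N. of_real (M i j) * g j) = \<mu> * g i}"
  have L: "normalized_laplacian G = mat N N (\<lambda>(i, j). M i j)"
    unfolding normalized_laplacian_entries M_def s_def xs_def N_def ..
  have Mg: "(\<Sum>j<N. of_real (M i j) * g j) = g i - (\<Sum>w\<in>nbrs G (xs ! i). f w) / r (xs ! i)"
    if i: "i < N" and g: "\<And>j. j < N \<Longrightarrow> g j = r (xs ! j) * f (xs ! j)" for i g f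
  proof -
    have "(\<Sum>j<N. of_real (M i j) * g j) = (\<Sum>j<N. (if j = i then g j else 0) -
        (if (xs ! i, xs ! j) \<in> parcs G then f (xs ! j) else 0) / r (xs ! i))"
      using r_nz[OF in_verts] g by (intro sum.cong) (auto simp: M_def s_r field_simps)
    also have "\<dots> = g i - (\<Sum>j<N. if (xs ! i, xs ! j) \<in> parcs G then f (xs ! j) else 0) / r (xs ! i)"
      using i by (simp add: sum_subtractf sum_divide_distrib)
    also have "(\<Sum>j<N. if (xs ! i, xs ! j) \<in> parcs G then f (xs ! j) else 0) =
        (\<Sum>w\<in>pverts G. if (xs ! i, w) \<in> parcs G then f w else 0)"
      by (rule sum.reindex_bij_betw[OF bij])
    also have "\<dots> = (\<Sum>w\<in>nbrs G (xs ! i). f w)"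
      using nbrs_subset pair_finite_verts
      by (intro sum.mono_neutral_cong_right) (auto simp: nbrs_def)
    finally show ?thesis .
  qed
  have iff: "(\<Sum>j<N. of_real (M i j) * g j) = \<mu> * g i \<longleftrightarrow>
      (\<Sum>w\<in>nbrs G (xs ! i). f w) = (1 - \<mu>) * of_nat (card (nbrs G (xs ! i))) * f (xs ! i)"
    if i: "i < N" and g: "\<And>j. j < N \<Longrightarrow> g j = r (xs ! j) * f (xs ! j)" for i g f
  proof -
    let ?S = "\<Sum>w\<in>nbrs G (xs ! i). f w" and ?r = "r (xs ! i)" and ?f = "f (xs ! i)"
    have move: "a - b = c \<longleftrightarrow> b = a - c" for a b c :: complex
      by (auto simp: diff_eq_eq eq_diff_eq add.commute)
    have "?r * ?f - ?S / ?r = \<mu> * (?r * ?f) \<longleftrightarrow> ?S / ?r = ?r * ?f - \<mu> * (?r * ?f)"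
      by (rule move)
    also have "\<dots> \<longleftrightarrow> ?S = (?r * ?f - \<mu> * (?r * ?f)) * ?r"
      using r_nz[OF in_verts[OF i]] by (rule nonzero_divide_eq_eq)
    also have "(?r * ?f - \<mu> * (?r * ?f)) * ?r = (1 - \<mu>) * (?r * ?r) * ?f" by (simp add: algebra_simps)
    finally have "?r * ?f - ?S / ?r = \<mu> * (?r * ?f) \<longleftrightarrow> ?S = (1 - \<mu>) * (?r * ?r) * ?f" .
    moreover have "(\<Sum>j<N. of_real (M i j) * g j) = ?r * ?f - ?S / ?r"
      using Mg[of i g f, OF i g] g[OF i] by simp
    ultimately show ?thesis using g[OF i] r2 by simp
  qed
  define \<Phi> where "\<Phi> = (\<lambda>f i. if i < N then r (xs ! i) * f (xs ! i) else 0)"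
  have "fs.dim (walk_eigenspace G (1 - \<mu>)) = fs.dim ?E"
  proof (rule dim_linear_bij[of \<Phi>])
    show "flinear \<Phi>" by (rule flinearI) (auto simp: \<Phi>_def fun_eq_iff algebra_simps)
    show "fs.subspace (walk_eigenspace G (1 - \<mu>))" by (rule subspace_walk_eigenspace)
  next
    fix f assume "f \<in> walk_eigenspace G (1 - \<mu>)"
    then have "(\<Sum>j<N. of_real (M i j) * \<Phi> f j) = \<mu> * \<Phi> f i" if "i < N" for i
      using iff[OF that, of "\<Phi> f" f] in_verts[OF that] by (simp add: \<Phi>_def walk_eigenspace_def)
    then show "\<Phi> f \<in> ?E" by (simp add: supported_on_def) (simp add: \<Phi>_def)
  next
    fix f assume f: "f \<in> walk_eigenspace G (1 - \<mu>)" "\<Phi> f = 0"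
    have "f v = 0" if v: "v \<in> pverts G" for v
    proof -
      obtain i where "i < N" "v = xs ! i" using v bij by (auto simp: bij_betw_def)
      then show ?thesis using fun_cong[OF f(2), of i] r_nz[OF v] by (simp add: \<Phi>_def)
    qed
    then show "f = 0" using f(1) by (force simp: walk_eigenspace_def supported_on_def fun_eq_iff)
  next
    fix g assume g: "g \<in> ?E"
    define k where "k = the_inv_into {..<N} ((!) xs)"
    have k: "k (xs ! i) = i" if "i < N" for i
      using the_inv_into_f_f[of "(!) xs" "{..<N}" i] bij that by (auto simp: k_def bij_betw_def)
    define f where "f = (\<lambda>v. if v \<in> pverts G then g (k v) / r v else 0)"
    have gf: "g j = r (xs ! j) * f (xs ! j)" if "j < N" for j
      using that in_verts[OF that] r_nz[OF in_verts[OF that]] k by (simp add: f_def)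
    have "f \<in> walk_eigenspace G (1 - \<mu>)"
    proof -
      have "(\<Sum>w\<in>nbrs G v. f w) = (1 - \<mu>) * of_nat (card (nbrs G v)) * f v" if v: "v \<in> pverts G" for v
      proof -
        obtain i where i: "i < N" "v = xs ! i" using v bij by (auto simp: bij_betw_def)
        show ?thesis using iff[OF i(1), of g f] gf g i by auto
      qed
      then show ?thesis by (simp add: walk_eigenspace_def supported_on_def f_def)
    qed
    moreover have "\<Phi> f = g" using g gf by (auto simp: \<Phi>_def supported_on_def fun_eq_iff)
    ultimately show "\<exists>f\<in>walk_eigenspace G (1 - \<mu>). \<Phi> f = g" by blast
  qed
  then show ?thesis
    using order_char_poly_symmetric[of N M \<mu>] sym by (simp add: eigenvalue_mult_def L)
qed

lemma (in pair_graph) is_eigenvalue_iff_mult: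
  "is_eigenvalue (normalized_laplacian G) \<mu> \<longleftrightarrow> eigenvalue_mult (normalized_laplacian G) \<mu> \<noteq> 0"
proof -
  let ?A = "map_mat complex_of_real (normalized_laplacian G)"
  have A: "?A \<in> carrier_mat (card (pverts G)) (card (pverts G))"
    by (simp add: normalized_laplacian_entries)
  have "char_poly ?A \<noteq> 0" using degree_monic_char_poly[OF A] by auto
  then show ?thesis
    unfolding is_eigenvalue_def eigenvalue_mult_def eigenvalue_root_char_poly[OF A]
    by (simp add: order_root)
qed

section \<open>Circulations and the extreme eigenvalues\<close>

text \<open>For \<open>\<sigma> = -1\<close> the next operators and spaces are the classical divergence, difference operator,
  flows and circulations. For \<open>\<sigma> = 1\<close> they are the unsigned analogues. Treating both signs together
  keeps the bipartite and the general case in one argument.\<close>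

definition arc_div :: "'a pair_pre_digraph \<Rightarrow> ('a \<times> 'a \<Rightarrow> complex) \<Rightarrow> 'a \<Rightarrow> complex" where
  "arc_div G h = (\<lambda>v. \<Sum>w\<in>nbrs G v. h (v, w))"

definition arc_diff :: "'a pair_pre_digraph \<Rightarrow> complex \<Rightarrow> ('a \<Rightarrow> complex) \<Rightarrow> 'a \<times> 'a \<Rightarrow> complex" where
  "arc_diff G \<sigma> f = (\<lambda>(v, w). if (v, w) \<in> parcs G then f v + \<sigma> * f w else 0)"

definition signed_flows :: "'a pair_pre_digraph \<Rightarrow> complex \<Rightarrow> ('a \<times> 'a \<Rightarrow> complex) set" where
  "signed_flows G \<sigma> = {h \<in> supported_on (parcs G). \<forall>v w. (v, w) \<in> parcs G \<longrightarrow> h (w, v) = \<sigma> * h (v, w)}"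

definition circulations :: "'a pair_pre_digraph \<Rightarrow> complex \<Rightarrow> ('a \<times> 'a \<Rightarrow> complex) set" where
  "circulations G \<sigma> = {h \<in> signed_flows G \<sigma>. arc_div G h = 0}"

lemma flinear_arc_div: "flinear (arc_div G)"
  by (rule flinearI) (auto simp: arc_div_def fun_eq_iff sum.distrib sum_distrib_left)

lemma flinear_arc_diff: "flinear (arc_diff G \<sigma>)"
  by (rule flinearI) (auto simp: arc_diff_def fun_eq_iff algebra_simps)

lemma subspace_signed_flows: "fs.subspace (signed_flows G \<sigma>)"
  by (auto simp: fs.subspace_def signed_flows_def supported_on_def algebra_simps)

context pair_graph
begin

lemma sum_arcs: "(\<Sum>(v, w)\<in>parcs G. F v w) = (\<Sum>v\<in>pverts G. \<Sum>w\<in>nbrs G v. F v w)"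
proof -
  have "parcs G = (SIGMA v:pverts G. nbrs G v)"
    by (auto simp: nbrs_def intro: in_arcsD1)
  then show ?thesis
    using pair_finite_verts by (simp add: sum.Sigma)
qed

lemma sum_arcs_swap: "(\<Sum>(v, w)\<in>parcs G. F v w) = (\<Sum>(v, w)\<in>parcs G. F w v)"
  by (rule sum.reindex_bij_witness[of _ prod.swap prod.swap]) (auto intro: arcs_symmetric)

text \<open>Summation by parts: the two terms of the conjugated factor contribute equally, because reversing
  all arcs exchanges them up to \<open>\<sigma> * \<sigma> = 1\<close>. The left-hand side is a sum of squared moduli. So the identity
  gives the kernel of the signed Laplacian as well as reality and bounds of eigenvalues.\<close>

lemma energy_identity:
  assumes \<sigma>: "\<sigma> * \<sigma> = 1" "cnj \<sigma> = \<sigma>"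
  shows "(\<Sum>(v, w)\<in>parcs G. (f v + \<sigma> * f w) * cnj (f v + \<sigma> * f w)) =
    2 * (\<Sum>v\<in>pverts G. cnj (f v) * (\<Sum>w\<in>nbrs G v. f v + \<sigma> * f w))"
proof -
  have rhs: "(\<Sum>v\<in>pverts G. cnj (f v) * (\<Sum>w\<in>nbrs G v. f v + \<sigma> * f w)) =
      (\<Sum>v\<in>pverts G. \<Sum>w\<in>nbrs G v. cnj (f v) * (f v + \<sigma> * f w))"
    by (simp only: sum_distrib_left)
  have swap: "\<sigma> * cnj (f v) * (f w + \<sigma> * f v) = cnj (f v) * (f v + \<sigma> * f w)" for v w
  proof -
    have "\<sigma> * cnj (f v) * (f w + \<sigma> * f v) = cnj (f v) * (\<sigma> * \<sigma> * f v + \<sigma> * f w)"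
      by (simp add: algebra_simps)
    then show ?thesis by (simp add: \<sigma>)
  qed
  have "(\<Sum>(v, w)\<in>parcs G. (f v + \<sigma> * f w) * cnj (f v + \<sigma> * f w)) =
      (\<Sum>(v, w)\<in>parcs G. cnj (f v) * (f v + \<sigma> * f w)) +
      (\<Sum>(v, w)\<in>parcs G. (\<sigma> * cnj (f w)) * (f v + \<sigma> * f w))"
    unfolding sum.distrib[symmetric] using \<sigma>(2) by (intro sum.cong) (auto simp: algebra_simps)
  also have "(\<Sum>(v, w)\<in>parcs G. (\<sigma> * cnj (f w)) * (f v + \<sigma> * f w)) =
      (\<Sum>(v, w)\<in>parcs G. (\<sigma> * cnj (f v)) * (f w + \<sigma> * f v))"
    by (rule sum_arcs_swap)
  finally show ?thesis
    unfolding sum_arcs swap mult_2 rhs .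
qed

lemma arc_diff_eq_0_iff:
  "arc_diff G \<sigma> f = 0 \<longleftrightarrow> (\<forall>(v, w)\<in>parcs G. f v + \<sigma> * f w = 0)"
  by (auto simp: arc_diff_def fun_eq_iff)

lemma arc_diff_eq_0_if_balanced:
  assumes \<sigma>: "\<sigma> * \<sigma> = 1" "cnj \<sigma> = \<sigma>"
    and "\<And>v. v \<in> pverts G \<Longrightarrow> (\<Sum>w\<in>nbrs G v. f v + \<sigma> * f w) = 0"
  shows "arc_diff G \<sigma> f = 0"
proof -
  have "(\<Sum>a\<in>parcs G. (f (fst a) + \<sigma> * f (snd a)) * cnj (f (fst a) + \<sigma> * f (snd a))) = 0"
    using energy_identity[OF \<sigma>, of f] assms(3) by (simp add: case_prod_unfold)
  then have "f (fst a) + \<sigma> * f (snd a) = 0" if "a \<in> parcs G" for a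
    by (rule sum_mult_cnj_eq_0[OF pair_finite_arcs _ that])
  then show ?thesis by (force simp: arc_diff_eq_0_iff)
qed

text \<open>At the extreme values \<open>-\<sigma> = 1\<close> and \<open>-\<sigma> = -1\<close> the eigenvalue equation says that the signed
  Laplacian annihilates \<open>f\<close>, and by positivity of the energy each arc term vanishes.\<close>

lemma walk_eigenspace_unit:
  assumes \<sigma>: "\<sigma> * \<sigma> = 1" "cnj \<sigma> = \<sigma>"
  shows "walk_eigenspace G (- \<sigma>) = {f \<in> supported_on (pverts G). arc_diff G \<sigma> f = 0}"
proof -
  have div: "(\<Sum>w\<in>nbrs G v. f v + \<sigma> * f w) =
      of_nat (card (nbrs G v)) * f v + \<sigma> * (\<Sum>w\<in>nbrs G v. f w)" for f v
    by (simp add: sum.distrib sum_distrib_left)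
  have 1: "(\<Sum>w\<in>nbrs G v. f v + \<sigma> * f w) = 0 \<longleftrightarrow>
      (\<Sum>w\<in>nbrs G v. f w) = - \<sigma> * of_nat (card (nbrs G v)) * f v" for f v
  proof -
    have "d + \<sigma> * s = 0 \<longleftrightarrow> s = - \<sigma> * d" for d s
    proof
      assume "d + \<sigma> * s = 0"
      then have "\<sigma> * d + \<sigma> * \<sigma> * s = 0" by (metis distrib_left mult.assoc mult_zero_right)
      then show "s = - \<sigma> * d" using \<sigma>(1) by (simp add: eq_neg_iff_add_eq_0 add.commute)
    next
      assume "s = - \<sigma> * d"
      then have "\<sigma> * s = - (\<sigma> * \<sigma> * d)" by simp
      then show "d + \<sigma> * s = 0" using \<sigma>(1) by simp
    qed
    then show ?thesis unfolding div by (simp add: mult.assoc)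
  qed
  have 2: "(\<forall>v\<in>pverts G. (\<Sum>w\<in>nbrs G v. f v + \<sigma> * f w) = 0) \<longleftrightarrow> arc_diff G \<sigma> f = 0" for f
  proof
    assume "\<forall>v\<in>pverts G. (\<Sum>w\<in>nbrs G v. f v + \<sigma> * f w) = 0"
    then show "arc_diff G \<sigma> f = 0" by (intro arc_diff_eq_0_if_balanced[OF \<sigma>]) blast
  next
    assume "arc_diff G \<sigma> f = 0"
    then show "\<forall>v\<in>pverts G. (\<Sum>w\<in>nbrs G v. f v + \<sigma> * f w) = 0"
      unfolding arc_diff_eq_0_iff nbrs_def by (intro ballI sum.neutral) auto
  qed
  show ?thesis unfolding walk_eigenspace_def using 1 2 by auto
qed

text \<open>Choosing one of the two arcs of every edge identifies signed flows with arbitrary functions on the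
  edges.\<close>

lemma dim_signed_flows:
  assumes \<sigma>: "\<sigma> * \<sigma> = 1"
  shows "fs.dim (signed_flows G \<sigma>) = card (edge_set G)"
proof -
  define orient where "orient = (\<lambda>e. SOME a. a \<in> parcs G \<and> {fst a, snd a} = e)"
  have orient: "orient e \<in> parcs G" "{fst (orient e), snd (orient e)} = e" if "e \<in> edge_set G" for e
  proof -
    have "\<exists>a. a \<in> parcs G \<and> {fst a, snd a} = e" using that by (force simp: edge_set_def)
    from someI_ex[OF this] show "orient e \<in> parcs G" "{fst (orient e), snd (orient e)} = e"
      by (simp_all add: orient_def)
  qed
  have edge: "{v, w} \<in> edge_set G" if "(v, w) \<in> parcs G" for v w
    using that by (auto simp: edge_set_def)
  have cases: "orient {v, w} = (v, w) \<or> orient {v, w} = (w, v)" if "(v, w) \<in> parcs G" for v w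
    using orient(2)[OF edge[OF that]] by (cases "orient {v, w}") (auto simp: doubleton_eq_iff)
  have "edge_set G = (\<lambda>(v, w). {v, w}) ` parcs G" by (auto simp: edge_set_def)
  then have fin: "finite (edge_set G)" using pair_finite_arcs by simp
  define \<Phi> where "\<Phi> = (\<lambda>(h :: 'a \<times> 'a \<Rightarrow> complex) e. if e \<in> edge_set G then h (orient e) else 0)"
  have "fs.dim (signed_flows G \<sigma>) = fs.dim (supported_on (edge_set G))"
  proof (rule dim_linear_bij[of \<Phi>])
    show "flinear \<Phi>" by (rule flinearI) (auto simp: \<Phi>_def fun_eq_iff)
    show "fs.subspace (signed_flows G \<sigma>)" by (rule subspace_signed_flows)
  next
    fix h :: "'a \<times> 'a \<Rightarrow> complex"
    show "\<Phi> h \<in> supported_on (edge_set G)" by (simp add: \<Phi>_def supported_on_def)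
  next
    fix h assume h: "h \<in> signed_flows G \<sigma>" "\<Phi> h = 0"
    have "h (v, w) = 0" if vw: "(v, w) \<in> parcs G" for v w
    proof -
      have "h (orient {v, w}) = 0" using fun_cong[OF h(2), of "{v, w}"] edge[OF vw] by (simp add: \<Phi>_def)
      moreover have "h (v, w) = \<sigma> * h (w, v)"
        using h(1) arcs_symmetric[OF vw] by (auto simp: signed_flows_def)
      ultimately show ?thesis using cases[OF vw] by auto
    qed
    then show "h = 0" using h(1) by (force simp: signed_flows_def supported_on_def fun_eq_iff)
  next
    fix k :: "'a set \<Rightarrow> complex" assume k: "k \<in> supported_on (edge_set G)"
    define h where "h = (\<lambda>(v, w). if (v, w) \<in> parcs G
      then (if orient {v, w} = (v, w) then 1 else \<sigma>) * k {v, w} else 0)"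
    have "h (w, v) = \<sigma> * h (v, w)" if vw: "(v, w) \<in> parcs G" for v w
    proof -
      have "v \<noteq> w" using vw by (rule no_loops')
      then show ?thesis
        using cases[OF vw] vw arcs_symmetric[OF vw] \<sigma>
        by (auto simp: h_def insert_commute simp flip: mult.assoc)
    qed
    then have "h \<in> signed_flows G \<sigma>" by (auto simp: signed_flows_def supported_on_def h_def)
    moreover have "\<Phi> h = k"
    proof
      fix e
      show "\<Phi> h e = k e"
      proof (cases "e \<in> edge_set G")
        case True
        then show ?thesis
          using orient[OF True] by (cases "orient e") (simp add: \<Phi>_def h_def)
      next
        case False
        then show ?thesis using k by (simp add: \<Phi>_def supported_on_def)
      qed
    qed
    ultimately show "\<exists>h\<in>signed_flows G \<sigma>. \<Phi> h = k" by blast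
  qed
  then show ?thesis using supported_on_finite_dim(2)[OF fin] by simp
qed

text \<open>The maps \<open>arc_div\<close> and \<open>arc_diff\<close> are adjoint up to a factor 2 between signed flows and
  functions on the vertices. So they have equal rank, and the kernel of the second is a walk
  eigenspace by \<open>walk_eigenspace_unit\<close>.\<close>

lemma dim_circulations:
  assumes \<sigma>: "\<sigma> * \<sigma> = 1" "cnj \<sigma> = \<sigma>"
  shows "fs.dim (circulations G \<sigma>) + card (pverts G) =
    fs.dim (walk_eigenspace G (- \<sigma>)) + card (edge_set G)"
proof -
  let ?W = "supported_on (pverts G)"
  have "fs.dim {h \<in> signed_flows G \<sigma>. arc_div G h = 0} + fs.dim ?W =
      fs.dim {f \<in> ?W. arc_diff G \<sigma> f = 0} + fs.dim (signed_flows G \<sigma>)"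
  proof (rule dim_kernel_adjoint[OF flinear_arc_div flinear_arc_diff])
    show "fs.subspace (signed_flows G \<sigma>)" by (rule subspace_signed_flows)
    show "finite_dim (signed_flows G \<sigma>)"
      using supported_on_finite_dim(1)[OF pair_finite_arcs]
      by (rule finite_dim_subset) (auto simp: signed_flows_def)
    show "fs.subspace ?W" by (rule subspace_supported_on)
    show "finite_dim ?W" by (rule supported_on_finite_dim(1)[OF pair_finite_verts])
    show "arc_div G ` signed_flows G \<sigma> \<subseteq> ?W"
      by (auto simp: arc_div_def supported_on_def nbrs_def intro!: sum.neutral dest: in_arcsD1)
    show "arc_diff G \<sigma> ` ?W \<subseteq> signed_flows G \<sigma>"
    proof safe
      fix f :: "'a \<Rightarrow> complex"
      have "arc_diff G \<sigma> f (w, v) = \<sigma> * arc_diff G \<sigma> f (v, w)" if "(v, w) \<in> parcs G" for v w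
      proof -
        have "arc_diff G \<sigma> f (w, v) = f w + \<sigma> * f v" "arc_diff G \<sigma> f (v, w) = f v + \<sigma> * f w"
          using that arcs_symmetric[OF that] by (simp_all add: arc_diff_def)
        moreover have "f w + \<sigma> * f v = \<sigma> * f v + \<sigma> * \<sigma> * f w" using \<sigma>(1) by simp
        ultimately show ?thesis by (simp only: distrib_left mult.assoc)
      qed
      then show "arc_diff G \<sigma> f \<in> signed_flows G \<sigma>"
        by (auto simp: arc_diff_def signed_flows_def supported_on_def)
    qed
  next
    fix f assume f: "f \<in> ?W" "arc_div G (arc_diff G \<sigma> f) = 0"
    have "(\<Sum>w\<in>nbrs G v. f v + \<sigma> * f w) = 0" for v
    proof -
      have "(\<Sum>w\<in>nbrs G v. f v + \<sigma> * f w) = arc_div G (arc_diff G \<sigma> f) v"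
        unfolding arc_div_def by (intro sum.cong) (auto simp: arc_diff_def nbrs_def)
      then show ?thesis using f(2) by simp
    qed
    then show "arc_diff G \<sigma> f = 0" by (intro arc_diff_eq_0_if_balanced[OF \<sigma>]) blast
  next
    fix h assume h: "h \<in> signed_flows G \<sigma>" "arc_diff G \<sigma> (arc_div G h) = 0"
    define f where "f = arc_div G h"
    have anti: "f v = - \<sigma> * f w" if "(v, w) \<in> parcs G" for v w
      using h(2) that by (auto simp: arc_diff_eq_0_iff f_def[symmetric] eq_neg_iff_add_eq_0)
    let ?s = "\<Sum>(v, w)\<in>parcs G. cnj (f v) * h (v, w)"
    \<comment> \<open>\<open>?s\<close> is the squared norm of \<open>f\<close>, and reversing all arcs negates it.\<close>
    have "?s = (\<Sum>(v, w)\<in>parcs G. cnj (f w) * h (w, v))" by (rule sum_arcs_swap)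
    also have "\<dots> = (\<Sum>(v, w)\<in>parcs G. - (cnj (f v) * h (v, w)))"
    proof (rule sum.cong[OF refl], unfold case_prod_unfold)
      fix a assume "a \<in> parcs G"
      then obtain v w where a: "a = (v, w)" and vw: "(v, w) \<in> parcs G" by (cases a) auto
      have "h (w, v) = \<sigma> * h (v, w)" using h(1) vw by (auto simp: signed_flows_def)
      moreover have "cnj (f v) = - \<sigma> * cnj (f w)" using anti[OF vw] \<sigma>(2) by simp
      ultimately show "cnj (f (snd a)) * h (snd a, fst a) = - (cnj (f (fst a)) * h (fst a, snd a))"
        by (simp add: a)
    qed
    also have "\<dots> = - ?s" by (simp add: sum_negf case_prod_unfold)
    finally have "?s = 0" by simp
    moreover have "(\<Sum>w\<in>nbrs G v. cnj (f v) * h (v, w)) = f v * cnj (f v)" for v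
      unfolding sum_distrib_left[symmetric] by (simp only: f_def arc_div_def mult.commute)
    then have "?s = (\<Sum>v\<in>pverts G. f v * cnj (f v))"
      unfolding sum_arcs by (simp only:)
    ultimately have "f v = 0" if "v \<in> pverts G" for v
      using sum_mult_cnj_eq_0[OF pair_finite_verts _ that] by simp
    moreover have "f v = 0" if "v \<notin> pverts G" for v
      using that by (auto simp: f_def arc_div_def nbrs_def intro!: sum.neutral dest: in_arcsD1)
    ultimately show "arc_div G h = 0" by (force simp: f_def fun_eq_iff)
  qed
  then show ?thesis
    unfolding circulations_def walk_eigenspace_unit[OF \<sigma>] dim_signed_flows[OF \<sigma>(1)]
      supported_on_finite_dim(2)[OF pair_finite_verts] .
qed

text \<open>For an eigenfunction the energy identity reads $E = 2(1 + \sigma c) \sum_v d_v |f(v)|^2$ with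
  $E \geq 0$. Thus $1 + c$ and $1 - c$ are both real and nonnegative.\<close>

lemma walk_eigenvalue_bounds:
  assumes deg: "\<And>v. v \<in> pverts G \<Longrightarrow> nbrs G v \<noteq> {}"
    and f: "f \<in> walk_eigenspace G c" "f \<noteq> 0"
  obtains r where "c = of_real r" "-1 \<le> r" "r \<le> 1"
proof -
  define D where "D = (\<Sum>v\<in>pverts G. real (card (nbrs G v)) * (cmod (f v))\<^sup>2)"
  have "D > 0"
  proof -
    obtain v where "f v \<noteq> 0" using f(2) by (auto simp: fun_eq_iff)
    moreover have "v \<in> pverts G" using f(1) calculation by (auto simp: walk_eigenspace_def supported_on_def)
    moreover have "card (nbrs G v) > 0" using deg[of v] calculation by (simp add: card_gt_0_iff)
    ultimately show ?thesis
      unfolding D_def using pair_finite_verts by (intro sum_pos2[of _ v]) auto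
  qed
  have nonneg: "\<exists>t\<ge>0. 1 + \<sigma> * c = complex_of_real t" if \<sigma>: "\<sigma> * \<sigma> = 1" "cnj \<sigma> = \<sigma>" for \<sigma>
  proof -
    define E where "E = (\<Sum>a\<in>parcs G. (cmod (f (fst a) + \<sigma> * f (snd a)))\<^sup>2)"
    have "complex_of_real E = (\<Sum>(v, w)\<in>parcs G. (f v + \<sigma> * f w) * cnj (f v + \<sigma> * f w))"
      unfolding E_def by (simp only: case_prod_unfold of_real_sum complex_norm_square)
    also have "\<dots> = 2 * (\<Sum>v\<in>pverts G. cnj (f v) * (\<Sum>w\<in>nbrs G v. f v + \<sigma> * f w))"
      by (rule energy_identity[OF \<sigma>])
    also have "(\<Sum>v\<in>pverts G. cnj (f v) * (\<Sum>w\<in>nbrs G v. f v + \<sigma> * f w)) =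
        (\<Sum>v\<in>pverts G. (1 + \<sigma> * c) * of_real (real (card (nbrs G v)) * (cmod (f v))\<^sup>2))"
    proof (rule sum.cong[OF refl])
      fix v assume v: "v \<in> pverts G"
      have "(\<Sum>w\<in>nbrs G v. f v + \<sigma> * f w) = of_nat (card (nbrs G v)) * f v + \<sigma> * (\<Sum>w\<in>nbrs G v. f w)"
        by (simp add: sum.distrib sum_distrib_left)
      also have "(\<Sum>w\<in>nbrs G v. f w) = c * of_nat (card (nbrs G v)) * f v"
        using f(1) v by (simp add: walk_eigenspace_def)
      finally have "cnj (f v) * (\<Sum>w\<in>nbrs G v. f v + \<sigma> * f w) =
          (1 + \<sigma> * c) * (of_nat (card (nbrs G v)) * (f v * cnj (f v)))"
        by (simp add: algebra_simps)
      then show "cnj (f v) * (\<Sum>w\<in>nbrs G v. f v + \<sigma> * f w) =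
          (1 + \<sigma> * c) * of_real (real (card (nbrs G v)) * (cmod (f v))\<^sup>2)"
        by (simp only: of_real_mult of_real_of_nat_eq complex_norm_square)
    qed
    also have "\<dots> = (1 + \<sigma> * c) * of_real D"
      unfolding D_def by (simp only: sum_distrib_left of_real_sum)
    finally have "complex_of_real E = 2 * ((1 + \<sigma> * c) * of_real D)" .
    then have "1 + \<sigma> * c = of_real (E / (2 * D))" using \<open>D > 0\<close> by (simp add: field_simps)
    moreover have "E / (2 * D) \<ge> 0" using \<open>D > 0\<close> by (simp add: E_def sum_nonneg)
    ultimately show ?thesis by blast
  qed
  obtain t where t: "t \<ge> 0" "1 + c = of_real t" using nonneg[of 1] by auto
  obtain u where u: "u \<ge> 0" "1 - c = of_real u" using nonneg[of "-1"] by auto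
  have c: "c = of_real (t - 1)" using t by (simp add: algebra_simps)
  have "complex_of_real u = of_real (2 - t)" using u(2) unfolding c by simp
  then have "u = 2 - t" by (simp only: of_real_eq_iff)
  then show ?thesis using that[OF c] t(1) u(1) by simp
qed

end

locale connected_graph = pair_graph G for G :: "'a pair_pre_digraph" +
  assumes connected: "Digraph_Component.connected (with_proj G)" and has_arc: "parcs G \<noteq> {}"
begin

text \<open>Induction along walks in a connected graph.\<close>

lemma arc_closed_everywhere:
  assumes "u \<in> pverts G" "P u" "\<And>v w. (v, w) \<in> parcs G \<Longrightarrow> P v \<Longrightarrow> P w" "v \<in> pverts G"
  shows "P v"
proof -
  have "strongly_connected (with_proj G)"
    using symmetric_connected_imp_strongly_connected connected sym_arcs by blast
  then have "u \<rightarrow>\<^sup>*\<^bsub>with_proj G\<^esub> v"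
    using assms(1,4) by (auto simp: strongly_connected_def)
  then have "(u, v) \<in> rtrancl_on (pverts G) (parcs G)" by (simp add: reachable_def)
  then have "P u \<longrightarrow> P v"
    by (induction rule: rtrancl_on.induct) (use assms(3) in auto)
  then show ?thesis using assms(2) by simp
qed

lemma degree_pos: "v \<in> pverts G \<Longrightarrow> nbrs G v \<noteq> {}"
proof -
  obtain a b where ab: "(a, b) \<in> parcs G" using has_arc by auto
  assume v: "v \<in> pverts G"
  have "a \<in> pverts G" "nbrs G a \<noteq> {}" using ab by (auto simp: nbrs_def intro: in_arcsD1)
  moreover have "nbrs G w \<noteq> {}" if "(v, w) \<in> parcs G" for v w
    using arcs_symmetric[OF that] by (auto simp: nbrs_def)
  ultimately show ?thesis
    using arc_closed_everywhere[of a "\<lambda>v. nbrs G v \<noteq> {}" v] v by blast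
qed

text \<open>By \<open>walk_eigenspace_unit\<close> an eigenfunction is multiplied by \<open>-\<sigma>\<close> along every arc, so in a connected
  graph its value at one vertex determines it.\<close>

lemma dim_walk_eigenspace_unit:
  assumes \<sigma>: "\<sigma> * \<sigma> = 1" "cnj \<sigma> = \<sigma>"
  shows "fs.dim (walk_eigenspace G (- \<sigma>)) =
    (if \<exists>f\<in>walk_eigenspace G (- \<sigma>). f \<noteq> 0 then 1 else 0)"
proof (cases "\<exists>f\<in>walk_eigenspace G (- \<sigma>). f \<noteq> 0")
  case True
  then obtain g where g: "g \<in> walk_eigenspace G (- \<sigma>)" "g \<noteq> 0" by blast
  obtain u where u: "g u \<noteq> 0" using g(2) by (auto simp: fun_eq_iff)
  have uV: "u \<in> pverts G" using g(1) u by (auto simp: walk_eigenspace_def supported_on_def)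
  have "f = fscale (f u / g u) g" if f: "f \<in> walk_eigenspace G (- \<sigma>)" for f
  proof -
    define h where "h = f - fscale (f u / g u) g"
    have h: "h \<in> walk_eigenspace G (- \<sigma>)"
      unfolding h_def using subspace_walk_eigenspace f g(1)
      by (intro fs.subspace_diff fs.subspace_scale)
    then have arc: "h v + \<sigma> * h w = 0" if "(v, w) \<in> parcs G" for v w
      using that by (auto simp: walk_eigenspace_unit[OF \<sigma>] arc_diff_eq_0_iff)
    have "h u = 0" using u by (simp add: h_def)
    moreover have "\<sigma> \<noteq> 0" using \<sigma>(1) by auto
    ultimately have "h v = 0" if "v \<in> pverts G" for v
      by (intro arc_closed_everywhere[where P = "\<lambda>v. h v = 0", OF uV _ _ that]) (use arc in force)+
    then have "h = 0" using h by (force simp: walk_eigenspace_def supported_on_def fun_eq_iff)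
    then show ?thesis by (simp add: h_def)
  qed
  moreover have "fscale c g \<in> walk_eigenspace G (- \<sigma>)" for c
    using subspace_walk_eigenspace g(1) by (rule fs.subspace_scale)
  ultimately have "walk_eigenspace G (- \<sigma>) = range (\<lambda>c. fscale c g)" by auto
  then show ?thesis using dim_multiples[OF g(2)] True by simp
next
  case False
  then have "walk_eigenspace G (- \<sigma>) = {0}"
    using fs.subspace_0[OF subspace_walk_eigenspace] by auto
  then show ?thesis using False by simp
qed

lemma dim_walk_eigenspace_one: "fs.dim (walk_eigenspace G 1) = 1"
proof -
  let ?f = "\<lambda>v. if v \<in> pverts G then 1 else 0 :: complex"
  have "?f \<in> walk_eigenspace G (- (- 1))"
    by (subst walk_eigenspace_unit)
      (auto simp: supported_on_def arc_diff_eq_0_iff dest: in_arcsD1 in_arcsD2)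
  moreover have "?f \<noteq> 0"
    using has_arc by (auto simp: fun_eq_iff dest: in_arcsD1)
  ultimately show ?thesis using dim_walk_eigenspace_unit[of "-1"] by auto
qed

text \<open>An eigenfunction at \<open>-1\<close> changes sign along every arc. Its two values split the vertices into the
  classes of a bipartition, and a bipartition gives such a function.\<close>

lemma dim_walk_eigenspace_minus_one:
  "fs.dim (walk_eigenspace G (- 1)) = (if bipartite G then 1 else 0)"
proof -
  have unit: "walk_eigenspace G (- 1) = {f \<in> supported_on (pverts G). arc_diff G 1 f = 0}"
    by (rule walk_eigenspace_unit) auto
  have "(\<exists>f\<in>walk_eigenspace G (- 1). f \<noteq> 0) \<longleftrightarrow> bipartite G"
  proof
    assume "\<exists>f\<in>walk_eigenspace G (- 1). f \<noteq> 0"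
    then obtain f where f: "f \<in> walk_eigenspace G (- 1)" "f \<noteq> 0" by blast
    obtain u where u: "f u \<noteq> 0" using f(2) by (auto simp: fun_eq_iff)
    have uV: "u \<in> pverts G" using f(1) u by (auto simp: walk_eigenspace_def supported_on_def)
    have arc: "f w = - f v" if "(v, w) \<in> parcs G" for v w
      using f(1) that by (auto simp: unit arc_diff_eq_0_iff eq_neg_iff_add_eq_0 add.commute)
    have all: "f v = f u \<or> f v = - f u" if "v \<in> pverts G" for v
      by (rule arc_closed_everywhere[where P = "\<lambda>v. f v = f u \<or> f v = - f u", OF uV _ _ that])
        (use arc in auto)
    let ?X = "{v \<in> pverts G. f v = f u}" and ?Y = "{v \<in> pverts G. f v = - f u}"
    have "pverts G = ?X \<union> ?Y" using all by auto
    moreover have "?X \<inter> ?Y = {}" using u by auto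
    moreover have "parcs G \<subseteq> ?X \<times> ?Y \<union> ?Y \<times> ?X"
    proof (rule subrelI)
      fix v w assume vw: "(v, w) \<in> parcs G"
      then show "(v, w) \<in> ?X \<times> ?Y \<union> ?Y \<times> ?X"
        using all[OF in_arcsD1[OF vw]] arc[OF vw] in_arcsD1[OF vw] in_arcsD2[OF vw] by auto
    qed
    ultimately show "bipartite G" unfolding bipartite_def by blast
  next
    assume "bipartite G"
    then obtain X Y where XY: "pverts G = X \<union> Y" "X \<inter> Y = {}" "parcs G \<subseteq> X \<times> Y \<union> Y \<times> X"
      unfolding bipartite_def by blast
    define f where "f = (\<lambda>v. if v \<in> X then 1 else if v \<in> Y then - 1 else 0 :: complex)"
    have "f \<in> walk_eigenspace G (- 1)"
      unfolding unit using XY by (auto simp: supported_on_def arc_diff_eq_0_iff f_def)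
    moreover have "f \<noteq> 0"
    proof
      assume "f = 0"
      then have "f v = 0" for v by simp
      moreover obtain v where "v \<in> X \<or> v \<in> Y" using has_arc XY(3) by fastforce
      ultimately show False unfolding f_def by (metis zero_neq_one neg_equal_0_iff_equal)
    qed
    ultimately show "\<exists>f\<in>walk_eigenspace G (- 1). f \<noteq> 0" by blast
  qed
  then show ?thesis using dim_walk_eigenspace_unit[of 1] by simp
qed

end

section \<open>Chebyshev polynomials\<close>

text \<open>\<open>cheb x k\<close> is $U_{k-1}(x)$, the Chebyshev polynomial of the second kind, which is
  $\sin(k\theta)/\sin\theta$ at $x = \cos\theta$. The shifted index makes the sequence start with 0 and 1, so
  that it is the fundamental solution of the recurrence. The argument ranges over a commutative
  ring, which covers real and complex arguments and, with \<open>[:0, 1:]\<close>, the polynomials themselves.\<close>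

fun cheb :: "'a::comm_ring_1 \<Rightarrow> nat \<Rightarrow> 'a" where
  "cheb x 0 = 0"
| "cheb x (Suc 0) = 1"
| "cheb x (Suc (Suc k)) = 2 * x * cheb x (Suc k) - cheb x k"

lemma a_poly_eq_cheb: "a_poly (int k - 1) \<mu> = cheb (1 - \<mu>) k"
proof (induction "1 - \<mu>" k rule: cheb.induct)
  case (3 k)
  have "int (Suc (Suc k)) - 1 - 1 = int (Suc k) - 1" "int (Suc (Suc k)) - 1 - 2 = int k - 1" by auto
  then show ?case using 3 by (subst a_poly.simps) auto
qed (simp_all add: a_poly.simps)

lemma cheb_add:
  "cheb x (Suc (a + b)) = cheb x (Suc a) * cheb x (Suc b) - cheb x a * cheb x b"
proof (induction a arbitrary: b)
  case (Suc a)
  show ?case using Suc[of "Suc b"] by (simp add: algebra_simps)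
qed simp

lemma cheb_cassini: "cheb x (Suc k) ^ 2 - cheb x (Suc (Suc k)) * cheb x k = 1"
  by (induction k) (auto simp: algebra_simps power2_eq_square)

text \<open>Factorizations behind the splitting of the spectrum for even path length. They are the algebraic
  form of product-to-sum formulas, such as $\sin 2m\theta + \sin\theta = 2 \sin((m+1/2)\theta) \cos((m-1/2)\theta)$
  for the last one.\<close>

lemma cheb_double:
  fixes x :: "'a::comm_ring_1" and k :: nat
  defines "p \<equiv> cheb x (Suc (Suc k))" and "q \<equiv> cheb x (Suc k)" and "r \<equiv> cheb x k"
  shows "cheb x (2 * Suc k) = q * (p - r)"
    and "cheb x (2 * Suc k + 1) = (p - q) * (p + q)"
    and "cheb x (2 * Suc k - 1) = q^2 - r^2"
    and "cheb x (2 * Suc k) + 1 = (p + q) * (q - r)"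
proof -
  have "2 * Suc k = Suc (k + Suc k)" by simp
  then show 1: "cheb x (2 * Suc k) = q * (p - r)"
    by (simp only: cheb_add) (simp add: p_def q_def r_def algebra_simps del: cheb.simps)
  have "2 * Suc k + 1 = Suc (Suc k + Suc k)" by simp
  then show "cheb x (2 * Suc k + 1) = (p - q) * (p + q)"
    by (simp only: cheb_add) (simp add: p_def q_def algebra_simps del: cheb.simps)
  have "2 * Suc k - 1 = Suc (k + k)" by simp
  then show "cheb x (2 * Suc k - 1) = q^2 - r^2"
    by (simp only: cheb_add) (simp add: q_def r_def power2_eq_square del: cheb.simps)
  have "q^2 - p * r = 1" unfolding p_def q_def r_def by (rule cheb_cassini)
  then show "cheb x (2 * Suc k) + 1 = (p + q) * (q - r)"
    unfolding 1 by (simp add: algebra_simps power2_eq_square)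
qed

text \<open>Read backwards, the sequence satisfies the same recurrence, and if it vanishes at \<open>n\<close> the reversed
  sequence also starts with 0. So it is a multiple of the original one.\<close>

lemma cheb_reflect:
  assumes "cheb x n = 0" "k \<le> n"
  shows "cheb x (n - k) = cheb x (n - 1) * cheb x k"
proof -
  have "(k \<le> n \<longrightarrow> cheb x (n - k) = cheb x (n - 1) * cheb x k) \<and>
        (Suc k \<le> n \<longrightarrow> cheb x (n - Suc k) = cheb x (n - 1) * cheb x (Suc k))"
  proof (induction k)
    case 0
    then show ?case using assms by simp
  next
    case (Suc k)
    have "cheb x (n - Suc (Suc k)) = cheb x (n - 1) * cheb x (Suc (Suc k))" if "Suc (Suc k) \<le> n"
    proof -
      have "n - k = Suc (Suc (n - Suc (Suc k)))" "n - Suc k = Suc (n - Suc (Suc k))"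
        using that by auto
      then have "cheb x (n - k) = 2 * x * cheb x (n - Suc k) - cheb x (n - Suc (Suc k))" by simp
      then show ?thesis using Suc that by (simp add: algebra_simps)
    qed
    then show ?case using Suc by auto
  qed
  then show ?thesis using assms(2) by blast
qed

lemma cheb_pred_zero_square:
  assumes "cheb x n = 0" "0 < n"
  shows "cheb x (n - 1) ^ 2 = 1"
  using cheb_reflect[OF assms(1), of "n - 1"] assms(2) by (simp add: power2_eq_square)

lemma cheb_one: "cheb 1 k = of_nat k"
  by (induction "1::'a" k rule: cheb.induct) (auto simp: algebra_simps)

lemma cheb_minus_one: "cheb (-1) k = - ((-1) ^ k * of_nat k)"
  by (induction "-1::'a" k rule: cheb.induct) (auto simp: algebra_simps)

lemma cheb_recurrence_unique:
  fixes g :: "nat \<Rightarrow> 'a::comm_ring_1"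
  assumes "\<And>k. 0 < k \<Longrightarrow> k < n \<Longrightarrow> g (k - 1) + g (k + 1) = 2 * x * g k"
  shows "k < n \<Longrightarrow> g (Suc k) = cheb x (Suc k) * g 1 - cheb x k * g 0"
proof (induction k rule: induct_nat_012)
  case 1
  then show ?case using assms[of 1] by (simp add: algebra_simps)
next
  case (ge2 k)
  have "g (Suc (Suc (Suc k))) = 2 * x * g (Suc (Suc k)) - g (Suc k)"
    using assms[of "Suc (Suc k)"] ge2.prems by (simp add: algebra_simps)
  then show ?case using ge2 by (simp add: algebra_simps)
qed simp

lemma cheb_cos: "cheb (cos t) k * sin t = sin (of_nat k * t)" for t :: real
proof (induction "cos t" k rule: cheb.induct)
  case (3 k)
  define a where "a = real (Suc k) * t"
  have "real (Suc (Suc k)) * t = a + t" "real k * t = a - t" by (simp_all add: a_def algebra_simps)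
  then have "sin (real (Suc (Suc k)) * t) + sin (real k * t) = 2 * cos t * sin (real (Suc k) * t)"
    by (simp only: sin_add sin_diff a_def[symmetric]) simp
  then show ?case using 3 by (simp add: algebra_simps)
qed simp_all

lemma of_real_cheb: "of_real (cheb x k) = (cheb (of_real x) k :: complex)"
  by (induction x k rule: cheb.induct) auto

lemma poly_cheb: "poly (cheb [:0, 1:] k) x = cheb x k"
  by (induction x k rule: cheb.induct) auto

lemma degree_cheb: "degree (cheb [:0, 1:] k :: complex poly) \<le> k - 1"
proof (induction "[:0, 1:] :: complex poly" k rule: cheb.induct)
  case (3 k)
  have "degree (2 * [:0, 1:] * cheb [:0, 1:] (Suc k) :: complex poly) \<le> Suc k"
    using 3(1) by (simp add: order.trans[OF degree_mult_le])
  then show ?case using 3 by (auto intro!: degree_diff_le)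
qed auto

text \<open>At $x = \cos(j\pi/m)$ with $m = k + 1$ the middle term $U_{m-1}$ vanishes for $0 < j < m$ and the two
  others are $(-1)^j$ and $-(-1)^j$, so \<open>w\<close> has the value $(-1)^j(1 - c)$. At the end points 1 and $-1$, where
  $j = 0$ and $j = m$, it has the sign of $(-1)^j$ as well, and the intermediate value theorem gives a root between any two consecutive
  points.\<close>

lemma cheb_combination_real_roots:
  fixes c :: real and k :: nat
  assumes c: "-1 < c" "c < 1"
  defines "w \<equiv> \<lambda>x::real. cheb x (Suc (Suc k)) - cheb x (Suc k) - c * (cheb x (Suc k) - cheb x k)"
  shows "\<exists>X. X \<subseteq> {-1<..<1} \<and> finite X \<and> card X = Suc k \<and> (\<forall>x\<in>X. w x = 0)"
proof -
  let ?m = "Suc k"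
  define a where "a = (\<lambda>j::nat. real j * pi / real ?m)"
  have a_less: "a i < a j" if "i < j" for i j
    unfolding a_def using that by (intro divide_strict_right_mono mult_strict_right_mono) auto
  have a_ends: "a 0 = 0" "a ?m = pi"
    unfolding a_def by (simp, rule nonzero_mult_div_cancel_left) simp
  have a_mono: "a i \<le> a j" if "i \<le> j" for i j
    using a_less[of i j] that by (cases "i = j") auto
  have a_bounds: "0 \<le> a j" "j \<le> ?m \<Longrightarrow> a j \<le> pi" for j
    using a_mono[of 0 j] a_mono[of j ?m] a_ends by auto
  define t where "t = (\<lambda>j. cos (a j))"
  have sign: "(-1) ^ j * w (t j) > 0" if j: "j \<le> ?m" for j
  proof -
    consider "j = 0" | "j = ?m" | "0 < j" "j < ?m" using j by linarith
    then show ?thesis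
    proof cases
      case 1
      then show ?thesis using c by (simp add: w_def t_def a_ends cheb_one del: cheb.simps)
    next
      case 2
      have "t ?m = -1" by (simp add: t_def a_ends)
      then have "(-1) ^ j * w (t j) = (2 * real k + 1) * (1 + c) + 2"
        unfolding w_def 2 by (simp add: cheb_minus_one algebra_simps del: cheb.simps)
      moreover have "(2 * real k + 1) * (1 + c) \<ge> 0" using c by simp
      ultimately show ?thesis by simp
    next
      case 3
      define \<theta> where "\<theta> = a j"
      have "0 < \<theta>" "\<theta> < pi" using 3 a_less[of 0 j] a_less[of j ?m] a_ends by (auto simp: \<theta>_def)
      then have s: "sin \<theta> > 0" by (rule sin_gt_zero)
      have m\<theta>: "real (Suc k) * \<theta> = real j * pi" by (simp add: \<theta>_def a_def field_simps)
      then have "real (Suc (Suc k)) * \<theta> = real j * pi + \<theta>" "real k * \<theta> = real j * pi - \<theta>"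
        by (simp_all add: algebra_simps)
      with m\<theta> have "cheb (cos \<theta>) (Suc (Suc k)) * sin \<theta> = (-1) ^ j * sin \<theta>"
        "cheb (cos \<theta>) (Suc k) * sin \<theta> = 0 * sin \<theta>"
        "cheb (cos \<theta>) k * sin \<theta> = (- ((-1) ^ j)) * sin \<theta>"
        unfolding cheb_cos by (simp_all add: sin_add sin_diff del: of_nat_Suc)
      then have "cheb (cos \<theta>) (Suc (Suc k)) = (-1) ^ j" "cheb (cos \<theta>) (Suc k) = 0"
        "cheb (cos \<theta>) k = - ((-1) ^ j)"
        using s mult_right_cancel[of "sin \<theta>"] by (metis less_irrefl)+
      then have "w (t j) = (-1) ^ j * (1 - c)"
        unfolding w_def t_def \<theta>_def[symmetric] by (simp add: algebra_simps del: cheb.simps)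
      then have "(-1) ^ j * w (t j) = 1 - c" by (cases "even j") auto
      then show ?thesis using c by simp
    qed
  qed
  have "continuous_on A (\<lambda>x. poly (cheb [:0, 1:] i) (x::real))" for A i
    by (intro continuous_intros)
  then have "continuous_on A (\<lambda>x::real. cheb x i)" for A i
    by (simp only: poly_cheb)
  then have cont: "continuous_on A w" for A
    unfolding w_def by (intro continuous_intros)
  have anti: "t (Suc j) < t j" if "j \<le> k" for j
    unfolding t_def using that by (intro cos_monotone_0_pi a_less a_bounds) auto
  have "\<exists>z. t (Suc j) < z \<and> z < t j \<and> w z = 0" if j: "j \<le> k" for j
  proof -
    have s: "(-1) ^ j * w (t j) > 0" "(-1) ^ j * w (t (Suc j)) < 0"
      using sign[of j] sign[of "Suc j"] j by auto
    have "continuous_on {t (Suc j)..t j} (\<lambda>x. (-1) ^ j * w x)" by (intro continuous_intros cont)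
    then obtain z where "t (Suc j) \<le> z" "z \<le> t j" "(-1) ^ j * w z = 0"
      using IVT'[of "\<lambda>x. (-1) ^ j * w x" "t (Suc j)" 0 "t j"] s anti[OF j] by auto
    moreover have "z \<noteq> t j" "z \<noteq> t (Suc j)" using s calculation by auto
    ultimately show ?thesis by (intro exI[of _ z]) auto
  qed
  then obtain z where z: "\<And>j. j \<le> k \<Longrightarrow> t (Suc j) < z j \<and> z j < t j \<and> w (z j) = 0" by metis
  have t_le: "t j \<le> t i" if "i \<le> j" "j \<le> ?m" for i j
    unfolding t_def using that by (intro cos_monotone_0_pi_le a_mono a_bounds) auto
  have z_less: "z j < z i" if "i < j" "j \<le> k" for i j
    using z[of i] z[of j] t_le[of "Suc i" j] that by auto
  have "inj_on z {..k}"
    by (rule linorder_inj_onI) (use z_less in force)+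
  then have "card (z ` {..k}) = Suc k" by (simp add: card_image)
  moreover have "z ` {..k} \<subseteq> {-1<..<1}"
  proof safe
    fix j assume j: "j \<le> k"
    have "t 0 = 1" "t ?m = -1" by (auto simp: t_def a_ends)
    then show "z j \<in> {-1<..<1}" using z[OF j] t_le[of 0 j] t_le[of "Suc j" ?m] j by auto
  qed
  ultimately show ?thesis using z by (intro exI[of _ "z ` {..k}"]) auto
qed

text \<open>The polynomial has degree at most \<open>k + 1\<close> and does not vanish at 1, so the real roots already found
  are all the complex ones.\<close>

lemma cheb_combination_roots:
  fixes c :: real and k :: nat
  assumes c: "-1 < c" "c < 1"
  defines "R \<equiv> {x::complex. cheb x (Suc (Suc k)) - cheb x (Suc k) = of_real c * (cheb x (Suc k) - cheb x k)}"
  shows "card R = Suc k" and "R \<subseteq> of_real ` {-1<..<1}"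
proof -
  define P :: "complex poly" where
    "P = cheb [:0, 1:] (Suc (Suc k)) - cheb [:0, 1:] (Suc k) -
         [:of_real c:] * (cheb [:0, 1:] (Suc k) - cheb [:0, 1:] k)"
  have R: "R = {x. poly P x = 0}"
    by (simp add: R_def P_def poly_cheb del: cheb.simps)
  have "poly P 1 = of_real (1 - c)" by (simp add: P_def poly_cheb cheb_one del: cheb.simps)
  then have "P \<noteq> 0" using c by (metis of_real_eq_0_iff poly_0 diff_gt_0_iff_gt less_irrefl)
  have d: "degree (cheb [:0, 1:] j :: complex poly) \<le> Suc k" if "j \<le> Suc (Suc k)" for j
    using degree_cheb[of j] that by auto
  have "degree ([:of_real c:] * (cheb [:0, 1:] (Suc k) - cheb [:0, 1:] k) :: complex poly) \<le> Suc k"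
    using degree_diff_le[OF d[of "Suc k"] d[of k]]
    by (intro order.trans[OF degree_mult_le]) (simp del: cheb.simps)
  then have "degree P \<le> Suc k"
    unfolding P_def by (intro degree_diff_le d) auto
  then have R_le: "card R \<le> Suc k" and fin: "finite R"
    using card_poly_roots_bound[OF \<open>P \<noteq> 0\<close>] poly_roots_finite[OF \<open>P \<noteq> 0\<close>] by (auto simp: R)
  obtain X :: "real set" where X: "X \<subseteq> {-1<..<1}" "card X = Suc k"
    "\<forall>x\<in>X. cheb x (Suc (Suc k)) - cheb x (Suc k) - c * (cheb x (Suc k) - cheb x k) = 0"
    using cheb_combination_real_roots[OF c, of k] by blast
  have "complex_of_real x \<in> R" if "x \<in> X" for x
  proof -
    have "complex_of_real (cheb x (Suc (Suc k)) - cheb x (Suc k)) = of_real (c * (cheb x (Suc k) - cheb x k))"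
      using X(3) that by (metis eq_iff_diff_eq_0)
    then show ?thesis by (simp add: R_def of_real_cheb del: cheb.simps)
  qed
  then have sub: "of_real ` X \<subseteq> R" by auto
  have "card (complex_of_real ` X) = Suc k" using X(2) by (simp add: card_image inj_on_def)
  then have "of_real ` X = R"
    using R_le fin sub card_mono card_subset_eq by (metis le_antisym)
  then show "card R = Suc k" "R \<subseteq> of_real ` {-1<..<1}" using X \<open>card (complex_of_real ` X) = Suc k\<close> by auto
qed

section \<open>Eigenfunctions of the polygon graph\<close>

text \<open>The hypotheses are the relations that hold when $U_{n-1}(x) = 0$ between the values \<open>f\<close> of an
  eigenfunction at the original vertices and its values \<open>h\<close> at the first vertices of the paths. Let
  $S$ be the sum of $\overline{f(v)}\, h(v,w)$ and $E$ that of $|f(v)|^2$ over all arcs. Summing around vertices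
  gives $S = (2x + \sigma)E$, and averaging over an arc and its reverse gives $S = xE$. Hence
  $(x + \sigma)E = 0$, and all terms of $E$ vanish.\<close>

lemma (in pair_graph) symmetrize_divergence:
  assumes neq: "x \<noteq> - \<sigma>" and \<sigma>: "\<sigma> * \<sigma> = 1" "cnj \<sigma> = \<sigma>"
    and anti: "\<And>v w. (v, w) \<in> parcs G \<Longrightarrow> f w = - \<sigma> * f v"
    and h: "\<And>v w. (v, w) \<in> parcs G \<Longrightarrow> h (w, v) = \<sigma> * h (v, w) - 2 * x * \<sigma> * f v"
    and div: "\<And>v. v \<in> pverts G \<Longrightarrow> (\<Sum>w\<in>nbrs G v. h (v, w)) = (2 * x + \<sigma>) * of_nat (card (nbrs G v)) * f v"
    and v: "v \<in> pverts G" "nbrs G v \<noteq> {}"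
  shows "f v = 0"
proof -
  let ?s = "\<Sum>(v, w)\<in>parcs G. cnj (f v) * h (v, w)" and ?e = "\<Sum>(v, w)\<in>parcs G. f v * cnj (f v)"
  have "?s = (\<Sum>v\<in>pverts G. \<Sum>w\<in>nbrs G v. (2 * x + \<sigma>) * (f v * cnj (f v)))"
    unfolding sum_arcs
  proof (rule sum.cong[OF refl])
    fix v assume v: "v \<in> pverts G"
    have "(\<Sum>w\<in>nbrs G v. cnj (f v) * h (v, w)) = cnj (f v) * (\<Sum>w\<in>nbrs G v. h (v, w))"
      by (simp only: sum_distrib_left)
    then show "(\<Sum>w\<in>nbrs G v. cnj (f v) * h (v, w)) = (\<Sum>w\<in>nbrs G v. (2 * x + \<sigma>) * (f v * cnj (f v)))"
      using div[OF v] by simp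
  qed
  then have 1: "?s = (2 * x + \<sigma>) * ?e"
    unfolding sum_arcs by (simp only: sum_distrib_left)
  have "?s = (\<Sum>(v, w)\<in>parcs G. cnj (f w) * h (w, v))" by (rule sum_arcs_swap)
  also have "\<dots> = (\<Sum>(v, w)\<in>parcs G. 2 * x * (f v * cnj (f v)) - cnj (f v) * h (v, w))"
  proof (rule sum.cong[OF refl], unfold case_prod_unfold)
    fix a assume "a \<in> parcs G"
    then obtain v w where a: "a = (v, w)" and vw: "(v, w) \<in> parcs G" by (cases a) auto
    have "cnj (f w) * h (w, v) = - \<sigma> * cnj (f v) * (\<sigma> * h (v, w) - 2 * x * \<sigma> * f v)"
      using anti[OF vw] h[OF vw] \<sigma>(2) by simp
    also have "\<dots> = (\<sigma> * \<sigma>) * (2 * x * (f v * cnj (f v)) - cnj (f v) * h (v, w))"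
      by (simp add: algebra_simps)
    finally show "cnj (f (snd a)) * h (snd a, fst a) =
        2 * x * (f (fst a) * cnj (f (fst a))) - cnj (f (fst a)) * h (fst a, snd a)"
      by (simp add: a \<sigma>)
  qed
  also have "\<dots> = 2 * x * ?e - ?s"
    by (simp add: case_prod_unfold sum_subtractf sum_distrib_left)
  finally have "2 * ?s = 2 * x * ?e" by (simp add: algebra_simps)
  then have "2 * ((x + \<sigma>) * ?e) = 0" unfolding 1 by (simp add: algebra_simps)
  then have "(x + \<sigma>) * ?e = 0" by simp
  then have "?e = 0" using neq by (auto simp: eq_neg_iff_add_eq_0)
  then have e: "(\<Sum>a\<in>parcs G. f (fst a) * cnj (f (fst a))) = 0" by (simp add: case_prod_unfold)
  obtain w where "(v, w) \<in> parcs G" using v by (auto simp: nbrs_def)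
  then show ?thesis using sum_mult_cnj_eq_0[OF pair_finite_arcs e, of "(v, w)"] by simp
qed

locale polygon = connected_graph G for G :: "'a pair_pre_digraph" +
  fixes n :: nat
  assumes n: "2 \<le> n"
begin

abbreviation "\<tau> \<equiv> polygon_graph n G"
abbreviation "pv \<equiv> path_vertex n"

lemma pv_0 [simp]: "pv v w 0 = Orig v" and pv_n [simp]: "pv v w n = Orig w"
  using n by (auto simp: path_vertex_def)

lemma pv_inner: "0 < k \<Longrightarrow> k < n \<Longrightarrow> pv v w k = Inner {(v, k), (w, n - k)}"
  by (simp add: path_vertex_def)

lemma pv_eq_inner:
  assumes "pv v w k = pv v' w' k'" "0 < k" "k < n"
  shows "0 < k'" "k' \<noteq> n" "k' \<le> n \<Longrightarrow> (v' = v \<and> w' = w \<and> k' = k) \<or> (v' = w \<and> w' = v \<and> k' = n - k)"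
proof -
  show k': "0 < k'" "k' \<noteq> n" using assms by (auto simp: path_vertex_def split: if_splits)
  then have "{(v, k), (w, n - k)} = {(v', k'), (w', n - k')}"
    using assms by (auto simp: path_vertex_def split: if_splits)
  then show "k' \<le> n \<Longrightarrow> (v' = v \<and> w' = w \<and> k' = k) \<or> (v' = w \<and> w' = v \<and> k' = n - k)"
    unfolding doubleton_eq_iff using assms k' by auto
qed

lemma pverts_polygon: "pverts \<tau> = Orig ` pverts G \<union> {pv v w k | v w k. (v, w) \<in> parcs G \<and> 0 < k \<and> k < n}"
  by (simp add: polygon_graph_def)

lemma Orig_in_pverts [simp]: "Orig v \<in> pverts \<tau> \<longleftrightarrow> v \<in> pverts G"
  by (auto simp: pverts_polygon pv_inner)

lemma pv_in_pverts: "(v, w) \<in> parcs G \<Longrightarrow> k \<le> n \<Longrightarrow> pv v w k \<in> pverts \<tau>"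
proof -
  assume vw: "(v, w) \<in> parcs G" and k: "k \<le> n"
  consider "k = 0" | "k = n" | "0 < k" "k < n" using k by linarith
  then show ?thesis
    using vw by cases (auto intro: in_arcsD1 in_arcsD2 simp: pverts_polygon[of ])
qed

lemma parcs_polygon: "(a, b) \<in> parcs \<tau> \<longleftrightarrow>
    (\<exists>v w. (v, w) \<in> parcs G \<and> a = Orig v \<and> b = Orig w) \<or>
    (\<exists>v w k. (v, w) \<in> parcs G \<and> k < n \<and> a = pv v w k \<and> b = pv v w (k + 1))"
  unfolding polygon_graph_def pair_pre_digraph.select_convs Un_iff mem_Collect_eq prod.inject by blast

lemma nbrs_Orig: "nbrs \<tau> (Orig v) = Orig ` nbrs G v \<union> (\<lambda>w. pv v w 1) ` nbrs G v"
proof -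
  have "k = 0 \<and> u = v" if "Orig v = pv u w k" "k < n" for u w k
    using that by (auto simp: path_vertex_def split: if_splits)
  then have "b \<in> nbrs \<tau> (Orig v) \<longleftrightarrow> b \<in> Orig ` nbrs G v \<union> (\<lambda>w. pv v w 1) ` nbrs G v" for b
    unfolding nbrs_def mem_Collect_eq parcs_polygon using n by fastforce
  then show ?thesis by blast
qed

text \<open>Both neighbours are listed because the arcs of the reversed path \<open>pv w v\<close> lead from \<open>pv v w k\<close> to
  \<open>pv v w (k - 1)\<close>.\<close>

lemma nbrs_pv:
  assumes vw: "(v, w) \<in> parcs G" and k: "0 < k" "k < n"
  shows "nbrs \<tau> (pv v w k) = {pv v w (k - 1), pv v w (k + 1)}"
proof
  show "nbrs \<tau> (pv v w k) \<subseteq> {pv v w (k - 1), pv v w (k + 1)}"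
  proof
    fix b assume "b \<in> nbrs \<tau> (pv v w k)"
    then have "(pv v w k, b) \<in> parcs \<tau>" by (simp add: nbrs_def)
    then obtain v' w' k' where *: "k' < n" "pv v w k = pv v' w' k'" "b = pv v' w' (k' + 1)"
      unfolding parcs_polygon pv_inner[OF k] by auto
    have "(v' = v \<and> w' = w \<and> k' = k) \<or> (v' = w \<and> w' = v \<and> k' = n - k)"
      using pv_eq_inner(3)[OF *(2) k] *(1) by simp
    then show "b \<in> {pv v w (k - 1), pv v w (k + 1)}"
    proof
      assume "v' = w \<and> w' = v \<and> k' = n - k"
      then have "b = pv w v (n - (k - 1))" using * k by (simp add: Suc_diff_le)
      then show ?thesis using path_vertex_rev[of n "k - 1" w v] k n by simp
    qed (use * in simp)
  qed
  have "pv v w (k - 1) = pv w v (n - k + 1)"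
    using path_vertex_rev[of n "k - 1" w v] k n by (simp add: Suc_diff_le)
  moreover have "pv v w k = pv w v (n - k)" using path_vertex_rev[of n k w v] k n by simp
  ultimately have "(pv v w k, pv v w (k - 1)) \<in> parcs \<tau>"
    using arcs_symmetric[OF vw] k unfolding parcs_polygon
    by (intro disjI2 exI[of _ w] exI[of _ v] exI[of _ "n - k"]) auto
  moreover have "(pv v w k, pv v w (k + 1)) \<in> parcs \<tau>"
    using vw k unfolding parcs_polygon by blast
  ultimately show "{pv v w (k - 1), pv v w (k + 1)} \<subseteq> nbrs \<tau> (pv v w k)"
    by (simp add: nbrs_def)
qed

lemma pv_Suc_neq:
  assumes "(v, w) \<in> parcs G" "k < n" shows "pv v w k \<noteq> pv v w (k + 1)"
proof
  assume eq: "pv v w k = pv v w (k + 1)"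
  have "v \<noteq> w" using assms(1) by (rule no_loops')
  show False
  proof (cases "k = 0")
    case True
    then show False using eq n by (simp add: pv_inner)
  next
    case False
    then show False using pv_eq_inner(3)[OF eq] assms(2) \<open>v \<noteq> w\<close> by auto
  qed
qed

lemma pv_around_neq:
  assumes "(v, w) \<in> parcs G" "0 < k" "k < n" shows "pv v w (k - 1) \<noteq> pv v w (k + 1)"
proof
  assume eq: "pv v w (k - 1) = pv v w (k + 1)"
  have "v \<noteq> w" using assms(1) by (rule no_loops')
  show False
  proof (cases "k = 1")
    case True
    then show False using eq assms(3) \<open>v \<noteq> w\<close> by (simp add: path_vertex_def split: if_splits)
  next
    case False
    then have "0 < k - 1" "k - 1 < n" "k + 1 \<le> n" using assms(2,3) by auto
    from pv_eq_inner(3)[OF eq this] show False using \<open>v \<noteq> w\<close> by auto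
  qed
qed

lemma pair_graph_polygon: "pair_graph \<tau>"
proof unfold_locales
  fix e assume e: "e \<in> parcs \<tau>"
  obtain a b where ab: "e = (a, b)" by (cases e)
  show "fst e \<in> pverts \<tau>" "snd e \<in> pverts \<tau>" "fst e \<noteq> snd e"
    using e pv_in_pverts pv_Suc_neq unfolding ab parcs_polygon
    by (auto intro: in_arcsD1 in_arcsD2 dest: no_loops')
next
  have "{pv v w k | v w k. (v, w) \<in> parcs G \<and> 0 < k \<and> k < n} \<subseteq> (\<lambda>((v, w), k). pv v w k) ` (parcs G \<times> {..n})"
    by force
  then have "finite {pv v w k | v w k. (v, w) \<in> parcs G \<and> 0 < k \<and> k < n}"
    by (rule finite_subset) (simp add: pair_finite_arcs)
  then show "finite (pverts \<tau>)"
    unfolding pverts_polygon using pair_finite_verts by simp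
  have "parcs \<tau> \<subseteq> (\<lambda>(v, w). (Orig v, Orig w)) ` parcs G \<union>
      (\<lambda>((v, w), k). (pv v w k, pv v w (k + 1))) ` (parcs G \<times> {..n})"
    by (force simp: polygon_graph_def)
  then show "finite (parcs \<tau>)"
    by (rule finite_subset) (simp add: pair_finite_arcs)
next
  have "(b, a) \<in> parcs \<tau>" if "(a, b) \<in> parcs \<tau>" for a b
    using that[unfolded parcs_polygon]
  proof (elim disjE exE conjE)
    fix v w assume "(v, w) \<in> parcs G" "a = Orig v" "b = Orig w"
    then show ?thesis using arcs_symmetric unfolding parcs_polygon by blast
  next
    fix v w k assume *: "(v, w) \<in> parcs G" "k < n" "a = pv v w k" "b = pv v w (k + 1)"
    have "a = pv w v (n - (k + 1) + 1)" "b = pv w v (n - (k + 1))"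
      using path_vertex_rev[of n k w v] path_vertex_rev[of n "k + 1" w v] * n
      by (simp_all add: Suc_diff_Suc)
    then show ?thesis
      using arcs_symmetric[OF *(1)] n unfolding parcs_polygon
      by (intro disjI2 exI[of _ w] exI[of _ v] exI[of _ "n - (k + 1)"]) auto
  qed
  then show "symmetric (with_proj \<tau>)" by (auto simp: symmetric_def intro: symI)
qed

lemma polygon_degree_pos: "u \<in> pverts \<tau> \<Longrightarrow> nbrs \<tau> u \<noteq> {}"
  using degree_pos nbrs_pv by (auto simp: pverts_polygon nbrs_Orig)

lemma sum_nbrs_Orig:
  "(\<Sum>u\<in>nbrs \<tau> (Orig v). f u) = (\<Sum>w\<in>nbrs G v. f (Orig w)) + (\<Sum>w\<in>nbrs G v. f (pv v w 1))"
  "card (nbrs \<tau> (Orig v)) = 2 * card (nbrs G v)"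
proof -
  have disj: "Orig ` nbrs G v \<inter> (\<lambda>w. pv v w 1) ` nbrs G v = {}"
    using n by (auto simp: path_vertex_def)
  have inj: "inj_on (\<lambda>w. pv v w 1) (nbrs G v)"
  proof (rule inj_onI)
    fix w w' assume w: "w \<in> nbrs G v" "w' \<in> nbrs G v" "pv v w 1 = pv v w' 1"
    then have "v \<noteq> w" using no_loops' by (auto simp: nbrs_def)
    then show "w = w'" using pv_eq_inner(3)[OF w(3)] n by auto
  qed
  have inj': "inj_on Orig (nbrs G v)" by (simp add: inj_on_def)
  show "(\<Sum>u\<in>nbrs \<tau> (Orig v). f u) = (\<Sum>w\<in>nbrs G v. f (Orig w)) + (\<Sum>w\<in>nbrs G v. f (pv v w 1))"
    unfolding nbrs_Orig
    by (subst sum.union_disjoint)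
      (simp_all only: finite_imageI finite_nbrs disj sum.reindex[OF inj] sum.reindex[OF inj'] comp_def)
  show "card (nbrs \<tau> (Orig v)) = 2 * card (nbrs G v)"
    unfolding nbrs_Orig
    by (subst card_Un_disjoint)
      (simp_all only: finite_imageI finite_nbrs disj card_image[OF inj] card_image[OF inj'] mult_2)
qed

lemma walk_eigenspace_polygon:
  "f \<in> walk_eigenspace \<tau> x \<longleftrightarrow> f \<in> supported_on (pverts \<tau>) \<and>
    (\<forall>v\<in>pverts G. (\<Sum>w\<in>nbrs G v. f (Orig w)) + (\<Sum>w\<in>nbrs G v. f (pv v w 1)) =
       2 * x * of_nat (card (nbrs G v)) * f (Orig v)) \<and>
    (\<forall>v w k. (v, w) \<in> parcs G \<longrightarrow> 0 < k \<longrightarrow> k < n \<longrightarrow>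
       f (pv v w (k - 1)) + f (pv v w (k + 1)) = 2 * x * f (pv v w k))"
proof -
  define P where "P = (\<lambda>u. (\<Sum>w\<in>nbrs \<tau> u. f w) = x * of_nat (card (nbrs \<tau> u)) * f u)"
  have "(\<forall>u\<in>pverts \<tau>. P u) \<longleftrightarrow> (\<forall>v\<in>pverts G. P (Orig v)) \<and>
      (\<forall>v w k. (v, w) \<in> parcs G \<longrightarrow> 0 < k \<longrightarrow> k < n \<longrightarrow> P (pv v w k))"
    unfolding pverts_polygon by blast
  moreover have "P (Orig v) \<longleftrightarrow> (\<Sum>w\<in>nbrs G v. f (Orig w)) + (\<Sum>w\<in>nbrs G v. f (pv v w 1)) =
       2 * x * of_nat (card (nbrs G v)) * f (Orig v)" for v
    unfolding P_def sum_nbrs_Orig by (simp add: mult_ac)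
  moreover have "P (pv v w k) \<longleftrightarrow> f (pv v w (k - 1)) + f (pv v w (k + 1)) = 2 * x * f (pv v w k)"
    if "(v, w) \<in> parcs G" "0 < k" "k < n" for v w k
    unfolding P_def nbrs_pv[OF that] using pv_around_neq[OF that] by (simp add: mult_ac)
  ultimately show ?thesis unfolding walk_eigenspace_def P_def by blast
qed

lemma walk_eigenspace_polygonD:
  assumes "f \<in> walk_eigenspace \<tau> x" "v \<in> pverts G"
  shows "(\<Sum>w\<in>nbrs G v. f (Orig w)) + (\<Sum>w\<in>nbrs G v. f (pv v w 1)) =
    2 * x * of_nat (card (nbrs G v)) * f (Orig v)"
  using assms unfolding walk_eigenspace_polygon by blast

lemma path_values:
  assumes "f \<in> walk_eigenspace \<tau> x" "(v, w) \<in> parcs G" "k < n"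
  shows "f (pv v w (Suc k)) = cheb x (Suc k) * f (pv v w 1) - cheb x k * f (Orig v)"
  using cheb_recurrence_unique[of n "\<lambda>k. f (pv v w k)" x k] assms
  unfolding walk_eigenspace_polygon by simp

lemma eigenvector_eq_0I:
  assumes f: "f \<in> walk_eigenspace \<tau> x"
    and "\<And>v. v \<in> pverts G \<Longrightarrow> f (Orig v) = 0" and "\<And>v w. (v, w) \<in> parcs G \<Longrightarrow> f (pv v w 1) = 0"
  shows "f = 0"
proof
  fix u
  show "f u = 0 u"
  proof (cases "u \<in> pverts \<tau>")
    case True
    then consider v where "v \<in> pverts G" "u = Orig v"
      | v w k where "(v, w) \<in> parcs G" "0 < k" "k < n" "u = pv v w k"
      unfolding pverts_polygon by blast
    then show ?thesis
    proof cases
      case 2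
      then have "f u = f (pv v w (Suc (k - 1)))" by simp
      then show ?thesis
        using path_values[OF f 2(1), of "k - 1"] 2 assms(2)[OF in_arcsD1[OF 2(1)]] assms(3)[OF 2(1)] by simp
    qed (use assms in simp)
  next
    case False
    then show ?thesis using f by (simp add: walk_eigenspace_def supported_on_def)
  qed
qed

text \<open>What remains of the eigenvalue equation on the vertices of \<open>G\<close> after elimination of the inner
  vertices of all paths.\<close>

definition lifted_eigenspace :: "complex \<Rightarrow> ('a \<Rightarrow> complex) set" where
  "lifted_eigenspace x = {f \<in> supported_on (pverts G). \<forall>v\<in>pverts G.
     (cheb x n + 1) * (\<Sum>w\<in>nbrs G v. f w) = cheb x (n + 1) * of_nat (card (nbrs G v)) * f v}"

lemma cheb_neighbours:
  assumes "0 < k" shows "cheb x (k - 1) + cheb x (k + 1) = 2 * x * cheb x k"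
  using assms by (cases k) auto

lemma cheb_neighbours_reflected:
  assumes "0 < k" "k < n" shows "cheb x (n - (k - 1)) + cheb x (n - (k + 1)) = 2 * x * cheb x (n - k)"
  using cheb_neighbours[of "n - k" x] assms by (simp add: Suc_diff_Suc add.commute Suc_diff_le)

text \<open>As $U_{n-1}(x) \neq 0$, the values on a path interpolate those at its ends, and restriction to the
  original vertices is injective. The inverse interpolates by
  $(U_{n-k-1}(x)\, g(v) + U_{k-1}(x)\, g(w)) / U_{n-1}(x)$ at distance $k$ from $v$.\<close>

lemma dim_walk_eigenspace_polygon_regular:
  assumes nz: "cheb x n \<noteq> 0"
  shows "fs.dim (walk_eigenspace \<tau> x) = fs.dim (lifted_eigenspace x)"
proof (rule dim_linear_bij[of "\<lambda>f v. f (Orig v)"])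
  let ?c = "cheb x"
  show "flinear (\<lambda>f v. f (Orig v))" by (rule flinearI) (auto simp: fun_eq_iff)
  show "fs.subspace (walk_eigenspace \<tau> x)" by (rule subspace_walk_eigenspace)
  have c2: "?c (n + 1) = 2 * x * ?c n - ?c (n - 1)"
    using n cheb_neighbours[of n x] by (simp add: algebra_simps)
  have first: "f (pv v w 1) = (f (Orig w) + ?c (n - 1) * f (Orig v)) / ?c n"
    if "f \<in> walk_eigenspace \<tau> x" "(v, w) \<in> parcs G" for f v w
    using path_values[OF that, of "n - 1"] n nz by (simp add: field_simps)
  show "(\<lambda>v. f (Orig v)) \<in> lifted_eigenspace x" if f: "f \<in> walk_eigenspace \<tau> x" for f
  proof -
    have "(?c n + 1) * (\<Sum>w\<in>nbrs G v. f (Orig w)) = ?c (n + 1) * of_nat (card (nbrs G v)) * f (Orig v)"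
      if v: "v \<in> pverts G" for v
    proof -
      let ?S = "\<Sum>w\<in>nbrs G v. f (Orig w)" and ?d = "of_nat (card (nbrs G v)) :: complex"
      have "(\<Sum>w\<in>nbrs G v. f (pv v w 1)) = (\<Sum>w\<in>nbrs G v. (f (Orig w) + ?c (n - 1) * f (Orig v)) / ?c n)"
        by (intro sum.cong refl first[OF f]) (simp add: nbrs_def)
      also have "\<dots> = (?S + ?d * (?c (n - 1) * f (Orig v))) / ?c n"
        by (simp add: sum_divide_distrib[symmetric] sum.distrib)
      finally have "?S + (?S + ?d * (?c (n - 1) * f (Orig v))) / ?c n = 2 * x * ?d * f (Orig v)"
        using walk_eigenspace_polygonD[OF f v] by (simp only:)
      then have "?c n * ?S + (?S + ?d * (?c (n - 1) * f (Orig v))) = ?c n * (2 * x * ?d * f (Orig v))"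
        using nz by (simp add: field_simps)
      then show ?thesis unfolding c2 by (simp add: algebra_simps)
    qed
    then show ?thesis
      using f by (auto simp: lifted_eigenspace_def walk_eigenspace_def supported_on_def)
  qed
  show "f = 0" if f: "f \<in> walk_eigenspace \<tau> x" "(\<lambda>v. f (Orig v)) = 0" for f
  proof (rule eigenvector_eq_0I[OF f(1)])
    show 0: "f (Orig v) = 0" for v using fun_cong[OF f(2), of v] by simp
    show "f (pv v w 1) = 0" if "(v, w) \<in> parcs G" for v w
      using first[OF f(1) that] 0 by simp
  qed
  show "\<exists>f\<in>walk_eigenspace \<tau> x. (\<lambda>v. f (Orig v)) = g" if g: "g \<in> lifted_eigenspace x" for g
  proof -
    \<comment> \<open>An inner vertex is named by the two pairs of an end and the distance from it, and the interpolation
      formula is a sum over these pairs, so no orientation of the edge has to be chosen.\<close>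
    define f where "f = (\<lambda>u. if u \<in> pverts \<tau> then (case u of Orig v \<Rightarrow> g v
      | Inner s \<Rightarrow> (\<Sum>(v, k)\<in>s. ?c (n - k) * g v) / ?c n) else 0)"
    have orig: "f (Orig v) = g v" for v
      using g by (simp add: f_def lifted_eigenspace_def supported_on_def)
    have path: "f (pv v w k) = (?c (n - k) * g v + ?c k * g w) / ?c n"
      if vw: "(v, w) \<in> parcs G" and k: "k \<le> n" for v w k
    proof -
      consider "k = 0" | "k = n" | "0 < k" "k < n" using k by linarith
      then show ?thesis
      proof cases
        case 3
        have "v \<noteq> w" using vw by (rule no_loops')
        then show ?thesis
          using pv_in_pverts[OF vw k] 3 by (simp add: f_def pv_inner)
      qed (use orig nz in simp_all)
    qed
    have "f \<in> walk_eigenspace \<tau> x"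
      unfolding walk_eigenspace_polygon
    proof (intro conjI ballI allI impI)
      show "f \<in> supported_on (pverts \<tau>)" by (simp add: f_def supported_on_def)
    next
      fix v assume v: "v \<in> pverts G"
      let ?S = "\<Sum>w\<in>nbrs G v. g w" and ?d = "of_nat (card (nbrs G v)) :: complex"
      have "(\<Sum>w\<in>nbrs G v. f (pv v w 1)) = (\<Sum>w\<in>nbrs G v. (?c (n - 1) * g v + g w) / ?c n)"
        using path[of v _ 1] n by (intro sum.cong) (auto simp: nbrs_def)
      also have "\<dots> = (?d * (?c (n - 1) * g v) + ?S) / ?c n"
        by (simp add: sum_divide_distrib[symmetric] sum.distrib)
      finally have 1: "(\<Sum>w\<in>nbrs G v. f (pv v w 1)) = (?d * (?c (n - 1) * g v) + ?S) / ?c n" .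
      have "(?c n + 1) * ?S = ?c (n + 1) * ?d * g v" using g v by (simp add: lifted_eigenspace_def)
      then have "?c n * ?S + (?d * (?c (n - 1) * g v) + ?S) = ?c n * (2 * x * ?d * g v)"
        unfolding c2 by (simp add: algebra_simps)
      then show "(\<Sum>w\<in>nbrs G v. f (Orig w)) + (\<Sum>w\<in>nbrs G v. f (pv v w 1)) = 2 * x * ?d * f (Orig v)"
        unfolding 1 orig using nz by (simp add: field_simps)
    next
      fix v w k assume vw: "(v, w) \<in> parcs G" and k: "0 < k" "k < n"
      have "f (pv v w (k - 1)) + f (pv v w (k + 1)) =
          ((?c (n - (k - 1)) + ?c (n - (k + 1))) * g v + (?c (k - 1) + ?c (k + 1)) * g w) / ?c n"
        using path[OF vw, of "k - 1"] path[OF vw, of "k + 1"] k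
        by (simp add: add_divide_distrib algebra_simps)
      also have "\<dots> = 2 * x * f (pv v w k)"
        unfolding cheb_neighbours[OF k(1)] cheb_neighbours_reflected[OF k]
        using path[OF vw, of k] k by (simp add: add_divide_distrib algebra_simps)
      finally show "f (pv v w (k - 1)) + f (pv v w (k + 1)) = 2 * x * f (pv v w k)" .
    qed
    then show ?thesis using orig by (intro bexI[of _ f]) auto
  qed
qed

text \<open>When $U_{n-1}(x) = 0$, eigenfunctions vanish on the original vertices by \<open>symmetrize_divergence\<close>. On
  the path from $v$ to $w$ they are $U_{k-1}(x)\, h(v,w)$, and reversing the path multiplies the amplitude
  $h$ by $\sigma = U_{n-2}(x) = \pm 1$. The equations at the original vertices say that the amplitudes around
  each of them sum to zero.\<close>

lemma dim_walk_eigenspace_polygon_singular: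
  assumes z: "cheb x n = 0"
  shows "fs.dim (walk_eigenspace \<tau> x) = fs.dim (circulations G (cheb x (n - 1)))"
proof -
  let ?c = "cheb x"
  define \<sigma> where "\<sigma> = ?c (n - 1)"
  have sq: "\<sigma>\<^sup>2 = 1" unfolding \<sigma>_def using cheb_pred_zero_square[OF z] n by simp
  have "\<sigma> = 1 \<or> \<sigma> = -1" using sq by (simp add: power2_eq_1_iff)
  then have \<sigma>: "\<sigma> * \<sigma> = 1" "cnj \<sigma> = \<sigma>" "\<sigma> = 1 \<or> \<sigma> = -1" by auto
  have neq: "x \<noteq> - \<sigma>"
    using \<sigma>(3) z n by (auto simp: cheb_one cheb_minus_one)
  have reflect: "?c (n - k) = \<sigma> * ?c k" if "k \<le> n" for k
    unfolding \<sigma>_def by (rule cheb_reflect[OF z that])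
  have vanish: "f (Orig v) = 0" if f: "f \<in> walk_eigenspace \<tau> x" and v: "v \<in> pverts G" for f v
  proof (rule symmetrize_divergence[OF neq \<sigma>(1,2), where h = "\<lambda>(v, w). f (pv v w 1)"])
    have anti: "f (Orig w) = - \<sigma> * f (Orig v)" if "(v, w) \<in> parcs G" for v w
      using path_values[OF f that, of "n - 1"] n z by (simp add: \<sigma>_def)
    then show "\<And>v w. (v, w) \<in> parcs G \<Longrightarrow> f (Orig w) = - \<sigma> * f (Orig v)" .
    show "(case (w, v) of (v, w) \<Rightarrow> f (pv v w 1)) =
        \<sigma> * (case (v, w) of (v, w) \<Rightarrow> f (pv v w 1)) - 2 * x * \<sigma> * f (Orig v)"
      if vw: "(v, w) \<in> parcs G" for v w
    proof -
      have "f (pv w v 1) = f (pv v w (Suc (n - 2)))"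
        using path_vertex_rev[of n 1 v w] n by (simp add: Suc_diff_Suc numeral_2_eq_2)
      also have "\<dots> = ?c (n - 1) * f (pv v w 1) - ?c (n - 2) * f (Orig v)"
        using path_values[OF f vw, of "n - 2"] n by (simp add: Suc_diff_Suc numeral_2_eq_2)
      also have "?c (n - 2) = \<sigma> * (2 * x)"
        using reflect[of 2] n by (simp add: numeral_2_eq_2)
      finally show ?thesis by (simp add: \<sigma>_def mult_ac)
    qed
    show "(\<Sum>w\<in>nbrs G v. case (v, w) of (v, w) \<Rightarrow> f (pv v w 1)) =
        (2 * x + \<sigma>) * of_nat (card (nbrs G v)) * f (Orig v)" if v: "v \<in> pverts G" for v
    proof -
      have "(\<Sum>w\<in>nbrs G v. f (Orig w)) = (\<Sum>w\<in>nbrs G v. - \<sigma> * f (Orig v))"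
        by (intro sum.cong refl anti) (simp add: nbrs_def)
      then have "- (of_nat (card (nbrs G v)) * (\<sigma> * f (Orig v))) + (\<Sum>w\<in>nbrs G v. f (pv v w 1)) =
          2 * x * of_nat (card (nbrs G v)) * f (Orig v)"
        using walk_eigenspace_polygonD[OF f v] by (simp only: sum_constant mult_minus_left mult_minus_right)
      then show ?thesis by (simp add: algebra_simps)
    qed
  qed (use v degree_pos in auto)
  define \<Phi> where "\<Phi> = (\<lambda>f (v, w). if (v, w) \<in> parcs G then f (pv v w 1) else (0::complex))"
  have "fs.dim (walk_eigenspace \<tau> x) = fs.dim (circulations G \<sigma>)"
  proof (rule dim_linear_bij[of \<Phi>])
    show "flinear \<Phi>" by (rule flinearI) (auto simp: \<Phi>_def fun_eq_iff)
    show "fs.subspace (walk_eigenspace \<tau> x)" by (rule subspace_walk_eigenspace)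
  next
    fix f assume f: "f \<in> walk_eigenspace \<tau> x"
    have "\<Phi> f (w, v) = \<sigma> * \<Phi> f (v, w)" if vw: "(v, w) \<in> parcs G" for v w
    proof -
      have "f (pv w v 1) = f (pv v w (Suc (n - 2)))"
        using path_vertex_rev[of n 1 v w] n by (simp add: Suc_diff_Suc numeral_2_eq_2)
      also have "\<dots> = ?c (n - 1) * f (pv v w 1)"
        using path_values[OF f vw, of "n - 2"] n vanish[OF f in_arcsD1[OF vw]]
        by (simp add: Suc_diff_Suc numeral_2_eq_2)
      finally show ?thesis using vw arcs_symmetric[OF vw] by (simp add: \<sigma>_def \<Phi>_def)
    qed
    then have flow: "\<Phi> f \<in> signed_flows G \<sigma>"
      unfolding signed_flows_def by (simp add: supported_on_def) (simp add: \<Phi>_def)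
    have "arc_div G (\<Phi> f) v = 0" for v
    proof (cases "v \<in> pverts G")
      case True
      have "arc_div G (\<Phi> f) v = (\<Sum>w\<in>nbrs G v. f (pv v w 1))"
        unfolding arc_div_def by (intro sum.cong) (auto simp: \<Phi>_def nbrs_def)
      moreover have "(\<Sum>w\<in>nbrs G v. f (Orig w)) = 0"
        using vanish[OF f] nbrs_subset by (intro sum.neutral) auto
      ultimately show ?thesis
        using walk_eigenspace_polygonD[OF f True] vanish[OF f True] by (simp only:) simp
    next
      case False
      then show ?thesis by (auto simp: arc_div_def nbrs_def intro!: sum.neutral dest: in_arcsD1)
    qed
    then show "\<Phi> f \<in> circulations G \<sigma>" using flow by (auto simp: circulations_def)
  next
    fix f assume f: "f \<in> walk_eigenspace \<tau> x" "\<Phi> f = 0"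
    show "f = 0"
    proof (rule eigenvector_eq_0I[OF f(1) vanish[OF f(1)]])
      show "f (pv v w 1) = 0" if "(v, w) \<in> parcs G" for v w
        using fun_cong[OF f(2), of "(v, w)"] that by (simp add: \<Phi>_def)
    qed
  next
    fix h assume h: "h \<in> circulations G \<sigma>"
    then have supp: "(v, w) \<notin> parcs G \<Longrightarrow> h (v, w) = 0"
      and flip: "(v, w) \<in> parcs G \<Longrightarrow> h (w, v) = \<sigma> * h (v, w)"
      and div: "(\<Sum>w\<in>nbrs G v. h (v, w)) = 0" for v w
      unfolding circulations_def signed_flows_def supported_on_def arc_div_def
      by (simp_all add: fun_eq_iff)
    \<comment> \<open>The double sum meets both orientations of the edge, which contribute the same; its diagonal
      terms vanish as \<open>h\<close> is supported on arcs.\<close>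
    define f where "f = (\<lambda>u. if u \<in> pverts \<tau> then (case u of Orig v \<Rightarrow> 0
      | Inner s \<Rightarrow> (\<Sum>(v, k)\<in>s. \<Sum>(w, l)\<in>s. ?c k * h (v, w)) / 2) else 0)"
    have orig: "f (Orig v) = 0" for v by (simp add: f_def)
    have path: "f (pv v w k) = ?c k * h (v, w)" if vw: "(v, w) \<in> parcs G" and k: "k \<le> n" for v w k
    proof -
      consider "k = 0" | "k = n" | "0 < k" "k < n" using k by linarith
      then show ?thesis
      proof cases
        case 3
        have "v \<noteq> w" using vw by (rule no_loops')
        moreover have "h (u, u) = 0" for u using supp no_loops' by blast
        moreover have "?c (n - k) * h (w, v) = ?c k * h (v, w)"
          using reflect[OF k] flip[OF vw] \<sigma>(1) by simp
        ultimately show ?thesis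
          using pv_in_pverts[OF vw k] 3 by (simp add: f_def pv_inner)
      qed (use orig z in simp_all)
    qed
    have "f \<in> walk_eigenspace \<tau> x"
      unfolding walk_eigenspace_polygon
    proof (intro conjI ballI allI impI)
      show "f \<in> supported_on (pverts \<tau>)" by (simp add: f_def supported_on_def)
    next
      fix v
      have "(\<Sum>w\<in>nbrs G v. f (pv v w 1)) = (\<Sum>w\<in>nbrs G v. h (v, w))"
        using path[of v _ 1] n by (intro sum.cong) (auto simp: nbrs_def)
      then show "(\<Sum>w\<in>nbrs G v. f (Orig w)) + (\<Sum>w\<in>nbrs G v. f (pv v w 1)) =
          2 * x * of_nat (card (nbrs G v)) * f (Orig v)"
        using div by (simp add: orig)
    next
      fix v w k assume vw: "(v, w) \<in> parcs G" and k: "0 < k" "k < n"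
      show "f (pv v w (k - 1)) + f (pv v w (k + 1)) = 2 * x * f (pv v w k)"
        using path[OF vw, of "k - 1"] path[OF vw, of "k + 1"] path[OF vw, of k] k
          cheb_neighbours[OF k(1), of x] by (simp flip: distrib_right mult.assoc)
    qed
    moreover have "\<Phi> f = h"
      using path[of _ _ 1] supp n by (auto simp: \<Phi>_def fun_eq_iff)
    ultimately show "\<exists>f\<in>walk_eigenspace \<tau> x. \<Phi> f = h" by blast
  qed
  then show ?thesis by (simp add: \<sigma>_def)
qed

end

section \<open>The spectrum for even path length\<close>

lemma cheb_not_stationary:
  fixes x :: complex
  shows "\<not> (cheb x (Suc (Suc k)) = cheb x (Suc k) \<and> cheb x (Suc k) = cheb x k)"
proof
  assume eq: "cheb x (Suc (Suc k)) = cheb x (Suc k) \<and> cheb x (Suc k) = cheb x k"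
  have "cheb x (Suc k) \<noteq> 0" using cheb_cassini[of x k] eq by auto
  moreover have "2 * x * cheb x (Suc k) = 2 * cheb x (Suc k)"
    using conjunct1[OF eq] unfolding cheb.simps diff_eq_eq conjunct2[OF eq, symmetric] mult_2[symmetric] .
  ultimately have "x = 1" by simp
  then show False using eq by (simp add: cheb_one del: cheb.simps)
qed

locale even_polygon = polygon G n for G :: "'a pair_pre_digraph" and n +
  fixes k :: nat
  assumes n_eq: "n = 2 * Suc k"
begin

text \<open>Here \<open>p\<close>, \<open>q\<close>, \<open>r\<close> are $a_m(\mu)$, $a_{m-1}(\mu)$, $a_{m-2}(\mu)$ for $m = n/2$ and $\mu = 1 - x$. By
  \<open>cheb_n\<close> the path polynomials of length $n$ factor in them, and each factor accounts for one part of
  the spectrum.\<close>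

context
  fixes x p q r :: complex
  assumes p: "p = cheb x (Suc (Suc k))" and q: "q = cheb x (Suc k)" and r: "r = cheb x k"
begin

lemma recurrence: "p + r = 2 * x * q"
  by (simp add: p q r)

lemma cassini: "q\<^sup>2 - p * r = 1"
  unfolding p q r by (rule cheb_cassini)

lemma cheb_n: "cheb x n = q * (p - r)" "cheb x (n + 1) = (p - q) * (p + q)"
    "cheb x (n - 1) = q\<^sup>2 - r\<^sup>2" "cheb x n + 1 = (p + q) * (q - r)"
  using cheb_double[of x k] unfolding n_eq p q r by simp_all

text \<open>By \<open>cassini\<close> the path polynomial of length \<open>n\<close> does not vanish here. Both sides of the equation on \<open>G\<close>
  contain the factor \<open>p + q\<close>, so every function on the vertices of \<open>G\<close> lifts.\<close>

lemma dim_at_free_root: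
  assumes "p + q = 0"
  shows "fs.dim (walk_eigenspace \<tau> x) = card (pverts G)"
proof -
  have pq: "p = - q" using assms by (simp add: eq_neg_iff_add_eq_0)
  have "q \<noteq> 0" "p \<noteq> r" using cassini unfolding pq by (auto simp: power2_eq_square)
  then have "cheb x n \<noteq> 0" by (simp add: cheb_n)
  moreover have "lifted_eigenspace x = supported_on (pverts G)"
    unfolding lifted_eigenspace_def cheb_n(2,4) assms by auto
  ultimately show ?thesis
    using dim_walk_eigenspace_polygon_regular supported_on_finite_dim(2)[OF pair_finite_verts] by simp
qed

lemma dim_if_lifted:
  assumes "q \<noteq> 0" "p \<noteq> r" "p + q \<noteq> 0" "q \<noteq> r"
  shows "fs.dim (walk_eigenspace \<tau> x) = fs.dim (walk_eigenspace G ((p - q) / (q - r)))"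
proof -
  have "cheb x n \<noteq> 0" using assms by (simp add: cheb_n)
  moreover have "(cheb x n + 1) * s = cheb x (n + 1) * d * f \<longleftrightarrow> s = (p - q) / (q - r) * d * f"
    for s d f
  proof -
    have "(cheb x n + 1) * s = cheb x (n + 1) * d * f \<longleftrightarrow>
        (p + q) * ((q - r) * s) = (p + q) * ((p - q) * d * f)"
      unfolding cheb_n(2,4) by (simp only: mult_ac)
    also have "\<dots> \<longleftrightarrow> (q - r) * s = (p - q) * d * f" using assms(3) by simp
    also have "\<dots> \<longleftrightarrow> s = (p - q) / (q - r) * d * f" using assms(4) by (auto simp: field_simps)
    finally show ?thesis .
  qed
  then have "lifted_eigenspace x = walk_eigenspace G ((p - q) / (q - r))"
    unfolding lifted_eigenspace_def walk_eigenspace_def by auto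
  ultimately show ?thesis using dim_walk_eigenspace_polygon_regular by simp
qed

text \<open>With \<open>q = 0\<close> the recurrence gives \<open>p = -r\<close>, so \<open>\<sigma> = q\<^sup>2 - r\<^sup>2 = -1\<close> by \<open>cassini\<close>, and the eigenspace is the
  ordinary cycle space.\<close>

lemma dim_at_cycle_root:
  assumes "q = 0"
  shows "fs.dim (walk_eigenspace \<tau> x) + card (pverts G) = card (edge_set G) + 1"
proof -
  have "p = - r" using recurrence assms by (simp add: eq_neg_iff_add_eq_0)
  then have "cheb x (n - 1) = - 1"
    unfolding cheb_n(3) using cassini assms by (simp add: power2_eq_square)
  moreover have "cheb x n = 0" using assms by (simp add: cheb_n)
  ultimately show ?thesis
    using dim_walk_eigenspace_polygon_singular dim_circulations[of "- 1"] dim_walk_eigenspace_one by simp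
qed

text \<open>With \<open>p = r\<close>, \<open>cassini\<close> gives \<open>\<sigma> = q\<^sup>2 - r\<^sup>2 = 1\<close>, so the amplitudes are symmetric, and bipartiteness decides
  whether the unsigned incidence matrix has full rank.\<close>

lemma dim_at_even_cycle_root:
  assumes "p = r"
  shows "fs.dim (walk_eigenspace \<tau> x) + card (pverts G) = card (edge_set G) + (if bipartite G then 1 else 0)"
proof -
  have "cheb x (n - 1) = 1"
    unfolding cheb_n(3) using cassini assms by (simp add: power2_eq_square)
  moreover have "cheb x n = 0" using assms by (simp add: cheb_n)
  ultimately show ?thesis
    using dim_walk_eigenspace_polygon_singular dim_circulations[of 1] dim_walk_eigenspace_minus_one by simp
qed

lemma dim_if_denominator_zero:
  assumes "q = r" "q \<noteq> 0" "p \<noteq> r" "p + q \<noteq> 0"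
  shows "fs.dim (walk_eigenspace \<tau> x) = 0"
proof -
  have nz: "cheb x n \<noteq> 0" using assms by (simp add: cheb_n)
  have on_verts: "f v = 0" if f: "f \<in> lifted_eigenspace x" and v: "v \<in> pverts G" for f v
  proof -
    have "(p - q) * (p + q) * of_nat (card (nbrs G v)) * f v = 0"
      using f v assms(1) unfolding lifted_eigenspace_def cheb_n(2,4) by auto
    then show ?thesis using assms degree_pos[OF v] by simp
  qed
  have "f = 0" if f: "f \<in> lifted_eigenspace x" for f
  proof
    fix v
    have "v \<notin> pverts G \<Longrightarrow> f v = 0" using f by (simp add: lifted_eigenspace_def supported_on_def)
    then show "f v = 0 v" using on_verts[OF f] by (cases "v \<in> pverts G") simp_all
  qed
  moreover have "0 \<in> lifted_eigenspace x"
    by (simp add: lifted_eigenspace_def supported_on_def)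
  ultimately have "lifted_eigenspace x = {0}" by blast
  then show ?thesis using dim_walk_eigenspace_polygon_regular[OF nz] by simp
qed

end

lemma nonzero_eigenvector:
  assumes "fs.dim (walk_eigenspace H x) \<noteq> 0"
  obtains f where "f \<in> walk_eigenspace H x" "f \<noteq> 0"
proof -
  have "walk_eigenspace H x \<noteq> {0}" using assms by auto
  then show ?thesis using that fs.subspace_0[OF subspace_walk_eigenspace] by blast
qed

lemma mult_G: "eigenvalue_mult (normalized_laplacian G) \<mu> = fs.dim (walk_eigenspace G (1 - \<mu>))"
  using degree_pos by (rule eigenvalue_mult_eq_dim)

lemma mult_polygon: "eigenvalue_mult (normalized_laplacian \<tau>) \<mu> = fs.dim (walk_eigenspace \<tau> (1 - \<mu>))"
  using polygon_degree_pos by (rule pair_graph.eigenvalue_mult_eq_dim[OF pair_graph_polygon])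

lemma a_poly_values:
  "a_poly (int n div 2) \<mu> = cheb (1 - \<mu>) (Suc (Suc k))"
  "a_poly (int n div 2 - 1) \<mu> = cheb (1 - \<mu>) (Suc k)"
  "a_poly (int n div 2 - 2) \<mu> = cheb (1 - \<mu>) k"
proof -
  have "int n div 2 = int (Suc (Suc k)) - 1" "int n div 2 - 1 = int (Suc k) - 1"
    "int n div 2 - 2 = int k - 1"
    unfolding n_eq by simp_all
  then show "a_poly (int n div 2) \<mu> = cheb (1 - \<mu>) (Suc (Suc k))"
    "a_poly (int n div 2 - 1) \<mu> = cheb (1 - \<mu>) (Suc k)"
    "a_poly (int n div 2 - 2) \<mu> = cheb (1 - \<mu>) k"
    by (simp_all only: a_poly_eq_cheb)
qed

lemma eigenvalue_equation_roots_eq: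
  "eigenvalue_equation_roots n l = {\<mu>. cheb (1 - \<mu>) (Suc (Suc k)) - cheb (1 - \<mu>) (Suc k) =
     (1 - l) * (cheb (1 - \<mu>) (Suc k) - cheb (1 - \<mu>) k)}"
proof -
  have iff: "(d \<noteq> 0 \<and> 1 - a / d = l) \<longleftrightarrow> a = (1 - l) * d" if "\<not> (a = 0 \<and> d = 0)" for a d :: complex
  proof (cases "d = 0")
    case False
    have "1 - a / d = l \<longleftrightarrow> a / d = 1 - l" by (auto simp: diff_eq_eq eq_diff_eq add.commute)
    also have "\<dots> \<longleftrightarrow> a = (1 - l) * d" using False by (rule nonzero_divide_eq_eq)
    finally show ?thesis using False by simp
  qed (use that in simp)
  have nt: "\<not> (cheb x (Suc (Suc k)) - cheb x (Suc k) = 0 \<and> cheb x (Suc k) - cheb x k = 0)" for x :: complex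
    using cheb_not_stationary[of x k] by simp
  show ?thesis
    unfolding eigenvalue_equation_roots_def a_poly_values iff[OF nt] ..
qed

lemma mult_at_zero: "eigenvalue_mult (normalized_laplacian \<tau>) 0 = 1"
proof -
  have "real (Suc (Suc k)) + real (Suc k) \<noteq> 0" by simp
  then have "of_nat (Suc (Suc k)) + of_nat (Suc k) \<noteq> (0::complex)" by (metis of_nat_add of_nat_eq_0_iff)
  moreover have "of_nat (Suc (Suc k)) \<noteq> (of_nat k :: complex)" "of_nat (Suc k) \<noteq> (0 :: complex)"
    by (simp_all only: of_nat_eq_iff of_nat_eq_0_iff)
  ultimately show ?thesis
    using dim_if_lifted[OF refl refl refl, of 1] dim_walk_eigenspace_one
    unfolding mult_polygon cheb_one by (simp del: of_nat_add)
qed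

text \<open>Since \<open>l\<close> is neither 0 nor 2, \<open>c = 1 - l\<close> lies strictly between \<open>-1\<close> and 1, and so do all solutions \<open>x\<close>. This
  keeps them away from the exceptional roots: \<open>q = 0\<close> would force \<open>c = 1\<close>, \<open>p = r\<close> would force \<open>c = -1\<close>,
  and \<open>p + q = 0\<close> would force \<open>c * x = 1\<close>. So \<open>dim_if_lifted\<close> applies at every
  solution.\<close>

lemma equation_roots:
  assumes l: "is_eigenvalue (normalized_laplacian G) l" "l \<noteq> 0" "l \<noteq> 2"
  shows "card (eigenvalue_equation_roots n l) = n div 2"
    and "\<mu> \<in> eigenvalue_equation_roots n l \<Longrightarrow>
      eigenvalue_mult (normalized_laplacian \<tau>) \<mu> = eigenvalue_mult (normalized_laplacian G) l"
proof -
  have "fs.dim (walk_eigenspace G (1 - l)) \<noteq> 0"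
    using l(1) unfolding is_eigenvalue_iff_mult mult_G .
  then obtain f where "f \<in> walk_eigenspace G (1 - l)" "f \<noteq> 0" by (rule nonzero_eigenvector)
  then obtain c where c: "1 - l = of_real c" "- 1 \<le> c" "c \<le> 1"
    using walk_eigenvalue_bounds[OF degree_pos] by metis
  have "c \<noteq> 1" "c \<noteq> - 1" using c(1) l(2,3) by (auto simp: algebra_simps)
  then have c': "- 1 < c" "c < 1" using c by auto
  let ?R = "{x::complex. cheb x (Suc (Suc k)) - cheb x (Suc k) = of_real c * (cheb x (Suc k) - cheb x k)}"
  have roots: "eigenvalue_equation_roots n l = {\<mu>. 1 - \<mu> \<in> ?R}"
    unfolding eigenvalue_equation_roots_eq c(1) by simp
  then have "eigenvalue_equation_roots n l = (\<lambda>x. 1 - x) ` ?R" by (force simp del: cheb.simps)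
  then show "card (eigenvalue_equation_roots n l) = n div 2"
    using cheb_combination_roots(1)[OF c', of k] by (simp add: card_image inj_on_def n_eq del: cheb.simps)
  assume "\<mu> \<in> eigenvalue_equation_roots n l"
  then have \<mu>: "1 - \<mu> \<in> ?R" using roots by simp
  define x p q r where "x = 1 - \<mu>" and "p = cheb x (Suc (Suc k))" and "q = cheb x (Suc k)" and "r = cheb x k"
  note pqr = p_def q_def r_def
  have eq: "p - q = of_real c * (q - r)" using \<mu> unfolding x_def[symmetric] mem_Collect_eq pqr[symmetric] .
  have rec: "p + r = 2 * x * q" and cas: "q\<^sup>2 - p * r = 1"
    using recurrence[OF pqr] cassini[OF pqr] by auto
  have ns: "\<not> (p = q \<and> q = r)" unfolding pqr by (rule cheb_not_stationary)
  have qr: "q \<noteq> r" using eq ns by auto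
  have cx: "of_real c * x \<noteq> 1"
  proof -
    obtain y where y: "x = of_real y" "- 1 < y" "y < 1"
      using cheb_combination_roots(2)[OF c', of k] \<mu> unfolding x_def[symmetric] by auto
    have "\<bar>c * y\<bar> < 1 * 1" unfolding abs_mult using c' y by (intro mult_strict_mono) auto
    then have "c * y \<noteq> 1" by auto
    then show ?thesis unfolding y(1) by (metis of_real_1 of_real_eq_iff of_real_mult)
  qed
  have q0: "q \<noteq> 0"
  proof
    assume q0: "q = 0"
    then have "p = - r" using rec by (simp add: eq_neg_iff_add_eq_0)
    then have "r * (1 - of_real c) = 0" using eq q0 by (simp add: algebra_simps)
    moreover have "1 - complex_of_real c \<noteq> 0" using c' by (simp add: of_real_eq_1_iff)
    ultimately show False using qr q0 by simp
  qed
  have pr: "p \<noteq> r"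
  proof
    assume "p = r"
    then have "(q - r) * (1 + of_real c) = 0" using eq by (simp add: algebra_simps)
    moreover have "1 + complex_of_real c \<noteq> 0" using c'
      by (metis add.commute eq_neg_iff_add_eq_0 less_irrefl of_real_1 of_real_add of_real_eq_0_iff)
    ultimately show False using qr by simp
  qed
  have pq: "p + q \<noteq> 0"
  proof
    assume "p + q = 0"
    then have "p = - q" by (simp add: eq_neg_iff_add_eq_0)
    then have "r = 2 * x * q + q" using rec by (simp add: algebra_simps)
    with eq \<open>p = - q\<close> have "2 * q * (of_real c * x - 1) = 0" by (simp add: algebra_simps)
    then show False using q0 cx by simp
  qed
  have "(p - q) / (q - r) = 1 - l" unfolding eq c(1) using qr by simp
  then show "eigenvalue_mult (normalized_laplacian \<tau>) \<mu> = eigenvalue_mult (normalized_laplacian G) l"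
    using dim_if_lifted[OF pqr q0 pr pq qr] unfolding mult_polygon mult_G x_def by simp
qed

text \<open>Away from the exceptional roots the restriction to \<open>G\<close> is an eigenfunction for
  \<open>l = 1 - (p - q) / (q - r)\<close>. Here \<open>l = 0\<close> would mean \<open>p + r = 2 * q\<close>, hence \<open>\<mu> = 0\<close> by \<open>recurrence\<close>, and
  \<open>l = 2\<close> would mean \<open>p = r\<close>.\<close>

lemma eigenvalue_cases:
  assumes ev: "is_eigenvalue (normalized_laplacian \<tau>) \<mu>"
    and p_def: "p = cheb (1 - \<mu>) (Suc (Suc k))" and q_def: "q = cheb (1 - \<mu>) (Suc k)"
    and r_def: "r = cheb (1 - \<mu>) k"
    and "\<mu> \<noteq> 0" "p + q \<noteq> 0" "q \<noteq> 0" "p \<noteq> r"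
  shows "\<exists>l. is_eigenvalue (normalized_laplacian G) l \<and> l \<noteq> 0 \<and> l \<noteq> 2 \<and>
    \<mu> \<in> eigenvalue_equation_roots n l"
proof -
  note pqr = p_def q_def r_def
  have nz: "fs.dim (walk_eigenspace \<tau> (1 - \<mu>)) \<noteq> 0"
    using ev unfolding pair_graph.is_eigenvalue_iff_mult[OF pair_graph_polygon] mult_polygon .
  then have qr: "q \<noteq> r" using dim_if_denominator_zero[OF pqr] assms(5-) by blast
  define l where "l = 1 - (p - q) / (q - r)"
  have "fs.dim (walk_eigenspace G (1 - l)) \<noteq> 0"
    using dim_if_lifted[OF pqr] assms(5-) qr nz by (simp add: l_def)
  then have "is_eigenvalue (normalized_laplacian G) l" unfolding is_eigenvalue_iff_mult mult_G .
  moreover have "l \<noteq> 0"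
  proof
    assume "l = 0"
    then have "p + r = 2 * q" using qr by (simp add: l_def field_simps)
    then have "2 * (1 - \<mu>) * q = 2 * q" using recurrence[OF pqr] by simp
    then show False using assms(5,7) by simp
  qed
  moreover have "l \<noteq> 2"
  proof
    assume "l = 2"
    then have "p - q = - (q - r)" using qr by (simp add: l_def field_simps)
    then show False using assms(8) by (simp add: algebra_simps)
  qed
  moreover have "\<mu> \<in> eigenvalue_equation_roots n l"
    unfolding eigenvalue_equation_roots_eq mem_Collect_eq pqr[symmetric] using qr by (simp add: l_def)
  ultimately show ?thesis by blast
qed

end

theorem theorem4p3:
  fixes G :: "'a pair_pre_digraph" and n :: nat
  assumes "pair_graph G" and "Digraph_Component.connected (with_proj G)" and "parcs G \<noteq> {}"
    and "n \<ge> 2" and "even n"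
  shows
    "\<comment> \<open>(i)\<close>
     eigenvalue_mult (normalized_laplacian (polygon_graph n G)) 0 = 1 \<and>
     \<comment> \<open>(ii)\<close>
     (\<forall>\<mu>. a_poly (int n div 2) \<mu> + a_poly (int n div 2 - 1) \<mu> = 0 \<longrightarrow>
       eigenvalue_mult (normalized_laplacian (polygon_graph n G)) \<mu> = card (pverts G)) \<and>
     \<comment> \<open>(iii)\<close>
     (\<forall>\<mu>. a_poly (int n div 2 - 1) \<mu> = 0 \<longrightarrow>
       int (eigenvalue_mult (normalized_laplacian (polygon_graph n G)) \<mu>)
         = int (card (edge_set G)) - int (card (pverts G)) + 1) \<and>
     \<comment> \<open>(iv)\<close>
     (\<not> bipartite G \<longrightarrow> (\<forall>\<mu>. a_poly (int n div 2) \<mu> - a_poly (int n div 2 - 2) \<mu> = 0 \<longrightarrow>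
       int (eigenvalue_mult (normalized_laplacian (polygon_graph n G)) \<mu>)
         = int (card (edge_set G)) - int (card (pverts G)))) \<and>
     \<comment> \<open>(v)\<close>
     (bipartite G \<longrightarrow> (\<forall>\<mu>. a_poly (int n div 2) \<mu> - a_poly (int n div 2 - 2) \<mu> = 0 \<longrightarrow>
       int (eigenvalue_mult (normalized_laplacian (polygon_graph n G)) \<mu>)
         = int (card (edge_set G)) - int (card (pverts G)) + 1)) \<and>
     \<comment> \<open>(vi)\<close>
     (\<forall>l. is_eigenvalue (normalized_laplacian G) l \<and> l \<noteq> 0 \<and> l \<noteq> 2 \<longrightarrow>
       card (eigenvalue_equation_roots n l) = n div 2 \<and>
       (\<forall>\<mu> \<in> eigenvalue_equation_roots n l.
         is_eigenvalue (normalized_laplacian (polygon_graph n G)) \<mu> \<and>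
         eigenvalue_mult (normalized_laplacian G) l
           = eigenvalue_mult (normalized_laplacian (polygon_graph n G)) \<mu>)) \<and>
     \<comment> \<open>every eigenvalue arises in one of these ways\<close>
     (\<forall>\<mu>. is_eigenvalue (normalized_laplacian (polygon_graph n G)) \<mu> \<longrightarrow>
       \<mu> = 0 \<or>
       a_poly (int n div 2) \<mu> + a_poly (int n div 2 - 1) \<mu> = 0 \<or>
       a_poly (int n div 2 - 1) \<mu> = 0 \<or>
       a_poly (int n div 2) \<mu> - a_poly (int n div 2 - 2) \<mu> = 0 \<or>
       (\<exists>l. is_eigenvalue (normalized_laplacian G) l \<and> l \<noteq> 0 \<and> l \<noteq> 2 \<and>
         \<mu> \<in> eigenvalue_equation_roots n l))"
proof -
  obtain k where "n = 2 * Suc k"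
    using assms(4,5) by (metis dvd_def mult_0_right not0_implies_Suc not_numeral_le_zero)
  with assms interpret even_polygon G n k
    by (simp add: even_polygon_def even_polygon_axioms_def polygon_def polygon_axioms_def
        connected_graph_def connected_graph_axioms_def)
  note dims = mult_polygon a_poly_values
  show ?thesis
  proof (intro conjI allI impI ballI; (elim conjE)?)
    show "eigenvalue_mult (normalized_laplacian \<tau>) 0 = 1" by (rule mult_at_zero)
  next
    fix \<mu> assume "a_poly (int n div 2) \<mu> + a_poly (int n div 2 - 1) \<mu> = 0"
    then show "eigenvalue_mult (normalized_laplacian \<tau>) \<mu> = card (pverts G)"
      unfolding dims by (rule dim_at_free_root[OF refl refl refl])
  next
    fix \<mu> assume "a_poly (int n div 2 - 1) \<mu> = 0"
    then show "int (eigenvalue_mult (normalized_laplacian \<tau>) \<mu>) =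
        int (card (edge_set G)) - int (card (pverts G)) + 1"
      unfolding dims using dim_at_cycle_root[OF refl refl refl, of "1 - \<mu>"] by linarith
  next
    fix \<mu> assume "\<not> bipartite G" "a_poly (int n div 2) \<mu> - a_poly (int n div 2 - 2) \<mu> = 0"
    then show "int (eigenvalue_mult (normalized_laplacian \<tau>) \<mu>) =
        int (card (edge_set G)) - int (card (pverts G))"
      unfolding dims using dim_at_even_cycle_root[OF refl refl refl, of "1 - \<mu>"] by simp
  next
    fix \<mu> assume "bipartite G" "a_poly (int n div 2) \<mu> - a_poly (int n div 2 - 2) \<mu> = 0"
    then show "int (eigenvalue_mult (normalized_laplacian \<tau>) \<mu>) =
        int (card (edge_set G)) - int (card (pverts G)) + 1"
      unfolding dims using dim_at_even_cycle_root[OF refl refl refl, of "1 - \<mu>"] by simp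
  next
    fix l assume l: "is_eigenvalue (normalized_laplacian G) l" "l \<noteq> 0" "l \<noteq> 2"
    show "card (eigenvalue_equation_roots n l) = n div 2" by (rule equation_roots(1)[OF l])
    fix \<mu> assume \<mu>: "\<mu> \<in> eigenvalue_equation_roots n l"
    show eq: "eigenvalue_mult (normalized_laplacian G) l = eigenvalue_mult (normalized_laplacian \<tau>) \<mu>"
      using equation_roots(2)[OF l \<mu>] by simp
    show "is_eigenvalue (normalized_laplacian \<tau>) \<mu>"
      using l(1) eq unfolding is_eigenvalue_iff_mult pair_graph.is_eigenvalue_iff_mult[OF pair_graph_polygon]
      by simp
  next
    fix \<mu> assume "is_eigenvalue (normalized_laplacian \<tau>) \<mu>"
    then show "\<mu> = 0 \<or> a_poly (int n div 2) \<mu> + a_poly (int n div 2 - 1) \<mu> = 0 \<or>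
        a_poly (int n div 2 - 1) \<mu> = 0 \<or> a_poly (int n div 2) \<mu> - a_poly (int n div 2 - 2) \<mu> = 0 \<or>
        (\<exists>l. is_eigenvalue (normalized_laplacian G) l \<and> l \<noteq> 0 \<and> l \<noteq> 2 \<and>
          \<mu> \<in> eigenvalue_equation_roots n l)"
      unfolding a_poly_values using eigenvalue_cases[OF _ refl refl refl] by (metis eq_iff_diff_eq_0)
  qed
qed

end
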